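(* Let $r>0$ and let $T$ be a finite metric tree with $|T|=L\ge2r$, and suppose that $\lambda(T)<2r$. Then $(T,r)$ has a replacement certificate in which every positive scale $s_j$ satisfies $s_j\le\lambda(T)/2$.
   Context: A finite metric tree is the metric realization of a finite combinatorial tree whose edges have positive lengths; $|T|$ is the total edge length and $d_T$ the path metric. A metric subtree of $T$ is a nonempty closed connected subset. A two-piece decomposition of $T$ is a pair of metric subtrees $T_1,T_2$ with $T=T_1\cup T_2$, $|T|=|T_1|+|T_2|$, and $T_1\cap T_2$ a single point. For nontrivial (not one-point) $T$, $\lambda(T)=\inf\max\{|T_1|,|T_2|\}$, the infimum over all two-piece decompositions $T=T_1\cup T_2$. For $s>0$, $\Lambda_{T,s}=\frac{|T|}{s}U[0,s]$, where $U[0,s]$ is the uniform probability measure on $[0,s]$ (viewed on $\mathbb R_{\ge0}$). Let $X_{T,r}=T\times[0,r]$ and $\pi(v,s)=s$. For a finite positive Borel measure $\eta$ on $X_{T,r}$, its coverage function is $c_\eta(x)=\eta(\{(v,s)\in X_{T,r}:d_T(x,v)\le s\})$, $x\in T$. A replacement certificate for $(T,r)$ consists of a finite positive Borel measure $\eta$ on $X_{T,r}$, finitely many scales $0<s_1,\dots,s_q<r$, and weights $w_1,\dots,w_q\ge0$ (possibly $q=0$; terms with zero weight are omitted) such that $c_\eta(x)+\sum_{j=1}^q w_j\ge1$ for every $x\in T$ and $\pi_*\eta+\sum_{j=1}^q w_j\Lambda_{T,s_j}\le\Lambda_{T,r}$, where $\mu\le\mu'$ means $\mu(A)\le\mu'(A)$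 for all Borel $A$. *)

theory Defs
  imports "HOL-Analysis.Analysis"
begin

section \<open>Finite combinatorial trees with edge lengths\<close>

text \<open>
  Every edge is stored once, with an arbitrary orientation. The orientation only serves to
  parametrize the edge \<open>e\<close> by the interval \<open>[0, elen T e]\<close>, from \<open>fst e\<close> to \<open>snd e\<close>.
\<close>

record 'v length_graph =
  verts :: "'v set"
  edges :: "('v \<times> 'v) set"
  elen :: "'v \<times> 'v \<Rightarrow> real"

definition adjacent :: "'v length_graph \<Rightarrow> 'v \<Rightarrow> 'v \<Rightarrow> bool" where
  "adjacent T u v \<longleftrightarrow> (u, v) \<in> edges T \<or> (v, u) \<in> edges T"

definition graph_cycle :: "'v length_graph \<Rightarrow> 'v list \<Rightarrow> bool" where
  "graph_cycle T vs \<longleftrightarrow> 3 \<le> length vs \<and> distinct vs \<and> successively (adjacent T) vs \<and>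
     adjacent T (last vs) (hd vs)"

text \<open>A finite connected acyclic simple graph whose edges have positive lengths.\<close>

definition finite_metric_tree :: "'v length_graph \<Rightarrow> bool" where
  "finite_metric_tree T \<longleftrightarrow>
     finite (verts T) \<and> verts T \<noteq> {} \<and>
     edges T \<subseteq> verts T \<times> verts T \<and>
     (\<forall>u v. (u, v) \<in> edges T \<longrightarrow> u \<noteq> v \<and> (v, u) \<notin> edges T) \<and>
     (\<forall>u\<in>verts T. \<forall>v\<in>verts T. (adjacent T)\<^sup>*\<^sup>* u v) \<and>
     (\<nexists>vs. graph_cycle T vs) \<and>
     (\<forall>e\<in>edges T. 0 < elen T e)"


section \<open>Metric realization\<close>

datatype 'v point = Vertex 'v | Inner "'v \<times> 'v" real

text \<open>The point at distance \<open>t\<close> from \<open>fst e\<close> on the closed edge \<open>e\<close>, for \<open>0 \<le> t \<le> elen T e\<close>.\<close>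

definition edge_point :: "'v length_graph \<Rightarrow> 'v \<times> 'v \<Rightarrow> real \<Rightarrow> 'v point" where
  "edge_point T e t =
     (if t = 0 then Vertex (fst e) else if t = elen T e then Vertex (snd e) else Inner e t)"

definition points :: "'v length_graph \<Rightarrow> 'v point set" where
  "points T = Vertex ` verts T \<union> (\<Union>e\<in>edges T. edge_point T e ` {0..elen T e})"

text \<open>
  \<open>joined T x a y\<close>: there is a path of length \<open>a\<close> from \<open>x\<close> to \<open>y\<close> which is a concatenation of
  finitely many segments, each contained in a closed edge.
\<close>

inductive joined :: "'v length_graph \<Rightarrow> 'v point \<Rightarrow> real \<Rightarrow> 'v point \<Rightarrow> bool"
  for T :: "'v length_graph" and x :: "'v point" where
  joined_refl: "x \<in> points T \<Longrightarrow> joined T x 0 x"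
| joined_step: "joined T x a (edge_point T e t) \<Longrightarrow> e \<in> edges T \<Longrightarrow>
    t \<in> {0..elen T e} \<Longrightarrow> t' \<in> {0..elen T e} \<Longrightarrow> joined T x (a + \<bar>t - t'\<bar>) (edge_point T e t')"

definition tree_dist :: "'v length_graph \<Rightarrow> 'v point \<Rightarrow> 'v point \<Rightarrow> real" where
  "tree_dist T x y =
     (if x \<in> points T \<and> y \<in> points T then Inf {a. joined T x a y} else 0)"

definition tree_topology :: "'v length_graph \<Rightarrow> 'v point topology" where
  "tree_topology T = Metric_space.mtopology (points T) (tree_dist T)"


section \<open>Subtrees, length and two-piece decompositions\<close>

definition metric_subtree :: "'v length_graph \<Rightarrow> 'v point set \<Rightarrow> bool" where
  "metric_subtree T S \<longleftrightarrow>
     S \<noteq> {} \<and> closedin (tree_topology T) S \<and> connectedin (tree_topology T) S"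

definition total_length :: "'v length_graph \<Rightarrow> real" where
  "total_length T = (\<Sum>e\<in>edges T. elen T e)"

text \<open>
  The total edge length of a subtree \<open>S\<close>. Its edges are the nondegenerate ones among the
  intersections of \<open>S\<close> with edges of the ambient tree.
\<close>

definition subtree_length :: "'v length_graph \<Rightarrow> 'v point set \<Rightarrow> real" where
  "subtree_length T S =
     (\<Sum>e\<in>edges T. measure lebesgue {t \<in> {0..elen T e}. edge_point T e t \<in> S})"

definition two_piece_decomposition ::
  "'v length_graph \<Rightarrow> 'v point set \<Rightarrow> 'v point set \<Rightarrow> bool" where
  "two_piece_decomposition T T1 T2 \<longleftrightarrow>
     metric_subtree T T1 \<and> metric_subtree T T2 \<and> points T = T1 \<union> T2 \<and>
     total_length T = subtree_length T T1 + subtree_length T T2 \<and> (\<exists>p. T1 \<inter> T2 = {p})"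

definition tree_lambda :: "'v length_graph \<Rightarrow> real" where
  "tree_lambda T = Inf {max (subtree_length T T1) (subtree_length T T2) | T1 T2.
     two_piece_decomposition T T1 T2}"


section \<open>Replacement certificates\<close>

definition borel_of :: "'a topology \<Rightarrow> 'a measure" where
  "borel_of X = sigma (topspace X) {U. openin X U}"

definition scale_law :: "'v length_graph \<Rightarrow> real \<Rightarrow> real measure" where
  "scale_law T s = scale_measure (ennreal (total_length T / s)) (uniform_measure lborel {0..s})"

definition scale_space ::
  "'v length_graph \<Rightarrow> real \<Rightarrow> ('v point \<times> real) topology" where
  "scale_space T r = prod_topology (tree_topology T) (top_of_set {0..r})"

definition coverage ::
  "'v length_graph \<Rightarrow> real \<Rightarrow> ('v point \<times> real) measure \<Rightarrow> 'v point \<Rightarrow> real" where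
  "coverage T r \<eta> x = measure \<eta> {(v, s). (v, s) \<in> points T \<times> {0..r} \<and> tree_dist T x v \<le> s}"

text \<open>
  The scales are \<open>s j\<close> and the weights \<open>w j\<close> for \<open>j < q\<close>. Measures on \<open>[0, \<infinity>)\<close> are represented by
  Borel measures on the real line giving no mass to the negative numbers.
\<close>

definition replacement_certificate ::
  "'v length_graph \<Rightarrow> real \<Rightarrow> ('v point \<times> real) measure \<Rightarrow>
     nat \<Rightarrow> (nat \<Rightarrow> real) \<Rightarrow> (nat \<Rightarrow> real) \<Rightarrow> bool" where
  "replacement_certificate T r \<eta> q s w \<longleftrightarrow>
     finite_measure \<eta> \<and>
     space \<eta> = points T \<times> {0..r} \<and> sets \<eta> = sets (borel_of (scale_space T r)) \<and>
     (\<forall>j<q. 0 < s j \<and> s j < r \<and> 0 \<le> w j) \<and>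
     (\<forall>x\<in>points T. 1 \<le> coverage T r \<eta> x + (\<Sum>j<q. w j)) \<and>
     (\<forall>A\<in>sets borel.
        emeasure (distr \<eta> borel snd) A + (\<Sum>j<q. ennreal (w j) * emeasure (scale_law T (s j)) A)
          \<le> emeasure (scale_law T r) A)"


section \<open>The realization is a metric space; measurability\<close>

lemma edge_point_in_points:
  "e \<in> edges T \<Longrightarrow> t \<in> {0..elen T e} \<Longrightarrow> edge_point T e t \<in> points T"
  unfolding points_def by blast

lemma joined_nonneg: "joined T x a y \<Longrightarrow> 0 \<le> a"
  by (induction rule: joined.induct) auto

lemma joined_points: "joined T x a y \<Longrightarrow> x \<in> points T \<and> y \<in> points T"
  by (induction rule: joined.induct) (auto simp: edge_point_in_points)

lemma joined_trans: "joined T y b z \<Longrightarrow> joined T x a y \<Longrightarrow> joined T x (a + b) z"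
proof (induction rule: joined.induct)
  case (joined_step b e t t')
  then show ?case
    using joined.joined_step[of T x "a + b" e t t'] by (simp add: add.assoc)
qed auto

lemma joined_sym: "joined T x a y \<Longrightarrow> joined T y a x"
proof (induction rule: joined.induct)
  case joined_refl
  then show ?case by (rule joined.joined_refl)
next
  case (joined_step a e t t')
  have "joined T (edge_point T e t') (0 + \<bar>t' - t\<bar>) (edge_point T e t)"
    using joined_step by (intro joined.joined_step joined.joined_refl edge_point_in_points)
  from joined_trans[OF joined_step.IH this] show ?case
    by (simp add: add.commute abs_minus_commute)
qed

lemma joined_edge:
  assumes "e \<in> edges T" "t \<in> {0..elen T e}" "t' \<in> {0..elen T e}"
  shows "joined T (edge_point T e t) \<bar>t - t'\<bar> (edge_point T e t')"
  using joined.joined_step[OF joined.joined_refl[OF edge_point_in_points] assms] assms by simp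

lemma joined_lipschitz:
  assumes lip: "\<And>e t t'. e \<in> edges T \<Longrightarrow> t \<in> {0..elen T e} \<Longrightarrow> t' \<in> {0..elen T e} \<Longrightarrow>
      \<bar>f (edge_point T e t) - f (edge_point T e t')\<bar> \<le> \<bar>t - t'\<bar>"
  shows "joined T x a y \<Longrightarrow> \<bar>f x - f y\<bar> \<le> a"
proof (induction rule: joined.induct)
  case (joined_step a e t t')
  then show ?case using lip[of e t t'] by linarith
qed simp

lemma finite_edges: "finite_metric_tree T \<Longrightarrow> finite (edges T)"
  unfolding finite_metric_tree_def by (meson finite_SigmaI finite_subset)

lemma joined_exists:
  assumes T: "finite_metric_tree T" and "x \<in> points T" "y \<in> points T"
  shows "\<exists>a. joined T x a y"
proof -
  have pos: "0 < elen T e" if "e \<in> edges T" for e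
    using T that by (auto simp: finite_metric_tree_def)
  have adj_joined: "\<exists>a. joined T (Vertex u) a (Vertex v)" if "adjacent T u v" for u v
  proof -
    have *: "joined T (Vertex (fst e)) (elen T e) (Vertex (snd e))" if "e \<in> edges T" for e
      using joined_edge[of e T 0 "elen T e"] pos[OF that] that by (simp add: edge_point_def)
    show ?thesis using *[of "(u, v)"] joined_sym[OF *[of "(v, u)"]] that
      by (auto simp: adjacent_def)
  qed
  have walk: "\<exists>a. joined T (Vertex u) a (Vertex v)" if "(adjacent T)\<^sup>*\<^sup>* u v" "u \<in> verts T" for u v
    using that
  proof (induction rule: rtranclp_induct)
    case base
    then have "Vertex u \<in> points T" by (simp add: points_def)
    then show ?case using joined_refl[of "Vertex u" T] by blast
  next
    case (step v v')
    then obtain a where a: "joined T (Vertex u) a (Vertex v)" by auto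
    obtain b where "joined T (Vertex v) b (Vertex v')" using adj_joined step.hyps(2) by blast
    from joined_trans[OF this a] show ?case by blast
  qed
  have vert: "\<exists>u\<in>verts T. \<exists>a. joined T (Vertex u) a z" if "z \<in> points T" for z
  proof -
    consider u where "u \<in> verts T" "z = Vertex u"
      | e t where "e \<in> edges T" "t \<in> {0..elen T e}" "z = edge_point T e t"
      using \<open>z \<in> points T\<close> unfolding points_def by (elim UnE imageE UN_E)
    then show ?thesis
    proof cases
      case 1
      then show ?thesis using joined_refl[of z T] \<open>z \<in> points T\<close> by blast
    next
      case 2
      have "fst e \<in> verts T" using T 2 by (auto simp: finite_metric_tree_def)
      moreover have "joined T (Vertex (fst e)) \<bar>0 - t\<bar> z"
        using joined_edge[of e T 0 t] pos[of e] 2 by (simp add: edge_point_def)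
      ultimately show ?thesis by blast
    qed
  qed
  obtain u a where u: "u \<in> verts T" "joined T (Vertex u) a x" using vert assms by blast
  obtain v b where v: "v \<in> verts T" "joined T (Vertex v) b y" using vert assms by blast
  have "(adjacent T)\<^sup>*\<^sup>* u v" using T u v by (auto simp: finite_metric_tree_def)
  then obtain c where "joined T (Vertex u) c (Vertex v)" using walk u by blast
  from joined_trans[OF this joined_sym[OF u(2)]] have "joined T x (a + c) (Vertex v)" .
  from joined_trans[OF v(2) this] show ?thesis by blast
qed

lemma joined_separated:
  assumes T: "finite_metric_tree T" and "x \<in> points T" "y \<in> points T" "x \<noteq> y"
  shows "\<exists>\<delta>>0. \<forall>a. joined T x a y \<longrightarrow> \<delta> \<le> a"
proof (cases x)
  case (Inner e s)
  have s: "e \<in> edges T" "0 < s" "s < elen T e"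
    using \<open>x \<in> points T\<close> Inner by (auto simp: points_def edge_point_def split: if_splits)
  define \<delta>0 where "\<delta>0 = min s (elen T e - s)"
  define f where "f = (\<lambda>z. case z of Vertex _ \<Rightarrow> \<delta>0
    | Inner e' t \<Rightarrow> if e' = e then min \<delta>0 \<bar>t - s\<bar> else \<delta>0)"
  have f: "f (edge_point T e' t) = (if e' = e then min \<delta>0 \<bar>t - s\<bar> else \<delta>0)"
    if "t \<in> {0..elen T e'}" for e' t
    using that s by (auto simp: f_def edge_point_def \<delta>0_def)
  have "\<bar>f x - f y\<bar> \<le> a" if "joined T x a y" for a
    using _ that by (rule joined_lipschitz) (auto simp: f)
  moreover have "f x = 0" using s by (auto simp: f_def Inner \<delta>0_def)
  moreover have "0 < f y"
    using s \<open>x \<noteq> y\<close> by (auto simp: f_def Inner \<delta>0_def split: point.splits)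
  ultimately show ?thesis by (intro exI[of _ "f y"]) auto
next
  case (Vertex v)
  define \<delta>0 where "\<delta>0 = Min (insert 1 (elen T ` edges T)) / 2"
  have fin: "finite (insert 1 (elen T ` edges T))" using finite_edges[OF T] by simp
  have pos: "0 < elen T e" if "e \<in> edges T" for e
    using T that by (auto simp: finite_metric_tree_def)
  have loop: "fst e \<noteq> snd e" if "e \<in> edges T" for e
    using T that by (cases e) (auto simp: finite_metric_tree_def)
  have d0: "0 < \<delta>0" using fin pos by (auto simp: \<delta>0_def)
  have d1: "\<delta>0 \<le> elen T e / 2" if "e \<in> edges T" for e
    using Min_le[OF fin, of "elen T e"] that by (simp add: \<delta>0_def)
  define f where "f = (\<lambda>z. case z of Vertex u \<Rightarrow> if u = v then 0 else \<delta>0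
    | Inner e t \<Rightarrow> if fst e = v then min \<delta>0 t
        else if snd e = v then min \<delta>0 (elen T e - t) else \<delta>0)"
  have f: "f (edge_point T e t) = (if fst e = v then min \<delta>0 t
        else if snd e = v then min \<delta>0 (elen T e - t) else \<delta>0)"
    if "e \<in> edges T" "t \<in> {0..elen T e}" for e t
    using that loop[of e] pos[of e] d1[of e] d0 by (auto simp: f_def edge_point_def)
  have "\<bar>f x - f y\<bar> \<le> a" if "joined T x a y" for a
    using _ that by (rule joined_lipschitz) (auto simp: f)
  moreover have "f x = 0" by (simp add: f_def Vertex)
  moreover have "0 < f y"
    using d0 \<open>x \<noteq> y\<close> \<open>y \<in> points T\<close>
    by (auto simp: f_def Vertex points_def edge_point_def split: point.splits if_splits)
  ultimately show ?thesis by (intro exI[of _ "f y"]) auto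
qed

lemma Metric_space_tree:
  assumes T: "finite_metric_tree T"
  shows "Metric_space (points T) (tree_dist T)"
proof -
  have d: "tree_dist T x y = Inf {a. joined T x a y}" if "x \<in> points T" "y \<in> points T" for x y
    using that by (simp add: tree_dist_def)
  have ne: "{a. joined T x a y} \<noteq> {}" if "x \<in> points T" "y \<in> points T" for x y
    using joined_exists[OF T that] by auto
  have le: "tree_dist T x y \<le> a" if "joined T x a y" for x y a
    using joined_points[OF that] that
    by (auto simp: d intro!: cInf_lower bdd_belowI[of _ 0] joined_nonneg)
  have ge: "c \<le> tree_dist T x y"
    if "x \<in> points T" "y \<in> points T" "\<And>a. joined T x a y \<Longrightarrow> c \<le> a" for x y c
    using that ne[of x y] by (auto simp: d intro!: cInf_greatest)
  have nonneg: "0 \<le> tree_dist T x y" for x y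
    using ge[of x y 0] joined_nonneg by (cases "x \<in> points T \<and> y \<in> points T") (auto simp: tree_dist_def)
  show ?thesis
  proof
    fix x y
    show "0 \<le> tree_dist T x y" by (rule nonneg)
    have "{a. joined T x a y} = {a. joined T y a x}" using joined_sym by blast
    then show "tree_dist T x y = tree_dist T y x" by (simp add: tree_dist_def)
  next
    fix x y assume xy: "x \<in> points T" "y \<in> points T"
    show "tree_dist T x y = 0 \<longleftrightarrow> x = y"
    proof
      assume 0: "tree_dist T x y = 0"
      show "x = y"
      proof (rule ccontr)
        assume "x \<noteq> y"
        then obtain \<delta> where "0 < \<delta>" "\<And>a. joined T x a y \<Longrightarrow> \<delta> \<le> a"
          using joined_separated[OF T xy] by blast
        then show False using ge[OF xy, of \<delta>] 0 by simp
      qed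
    next
      assume "x = y"
      then show "tree_dist T x y = 0"
        using le[OF joined_refl[OF xy(1)]] nonneg[of x x] by simp
    qed
  next
    fix x y z assume xyz: "x \<in> points T" "y \<in> points T" "z \<in> points T"
    have "tree_dist T x z - b \<le> tree_dist T x y" if "joined T y b z" for b
      using xyz le joined_trans[OF that] by (intro ge) (auto simp: algebra_simps)
    then have "tree_dist T x z - tree_dist T x y \<le> tree_dist T y z"
      using xyz by (intro ge) (auto simp: algebra_simps)
    then show "tree_dist T x z \<le> tree_dist T x y + tree_dist T y z" by simp
  qed
qed

lemma topspace_tree_topology: "finite_metric_tree T \<Longrightarrow> topspace (tree_topology T) = points T"
  unfolding tree_topology_def by (rule Metric_space.topspace_mtopology[OF Metric_space_tree])

lemma topspace_scale_space:
  "finite_metric_tree T \<Longrightarrow> topspace (scale_space T r) = points T \<times> {0..r}"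
  by (simp add: scale_space_def topspace_tree_topology)

lemma sets_borel_of: "sets (borel_of X) = sigma_sets (topspace X) {U. openin X U}"
  unfolding borel_of_def by (rule sets_measure_of) (auto dest: openin_subset)

lemma space_borel_of: "space (borel_of X) = topspace X"
  unfolding borel_of_def by (rule space_measure_of) (auto dest: openin_subset)

lemma snd_measurable_scale_space: "snd \<in> measurable (borel_of (scale_space T r)) borel"
proof (rule borel_measurableI)
  fix U :: "real set" assume "open U"
  have "continuous_map (scale_space T r) euclidean snd"
    unfolding scale_space_def
    using continuous_map_snd continuous_map_in_subtopology by blast
  then have "openin (scale_space T r) {p \<in> topspace (scale_space T r). snd p \<in> U}"
    using \<open>open U\<close> by (auto dest: openin_continuous_map_preimage)
  moreover have "snd -` U \<inter> space (borel_of (scale_space T r)) =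
      {p \<in> topspace (scale_space T r). snd p \<in> U}"
    by (auto simp: space_borel_of)
  ultimately show "snd -` U \<inter> space (borel_of (scale_space T r)) \<in> sets (borel_of (scale_space T r))"
    by (auto simp: sets_borel_of intro: sigma_sets.Basic)
qed

lemma coverage_set_measurable:
  assumes T: "finite_metric_tree T" and x: "x \<in> points T"
  shows "{(v, s). (v, s) \<in> points T \<times> {0..r} \<and> tree_dist T x v \<le> s}
    \<in> sets (borel_of (scale_space T r))"
proof -
  interpret Metric_space "points T" "tree_dist T" by (rule Metric_space_tree[OF T])
  let ?X = "scale_space T r"
  have fst: "continuous_map ?X (tree_topology T) fst"
    unfolding scale_space_def by (rule continuous_map_fst)
  have snd: "continuous_map ?X euclideanreal snd"
    unfolding scale_space_def
    using continuous_map_snd continuous_map_in_subtopology by blast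
  have "continuous_map mtopology euclideanreal (tree_dist T x)"
    using x continuous_map_mdist[of mtopology "metric (points T, tree_dist T)" "\<lambda>_. x" "\<lambda>v. v"]
    by (simp only: mtopology_of mdist_metric) simp
  then have "continuous_map ?X euclideanreal (tree_dist T x \<circ> fst)"
    using continuous_map_compose[OF fst] by (simp add: tree_topology_def)
  then have "continuous_map ?X euclideanreal (\<lambda>p. snd p - tree_dist T x (fst p))"
    using continuous_map_diff[OF snd] by (simp add: o_def)
  then have "closedin ?X {p \<in> topspace ?X. snd p - tree_dist T x (fst p) \<in> {0..}}"
    by (rule closedin_continuous_map_preimage[where Y = euclideanreal]) simp
  moreover have "{p \<in> topspace ?X. snd p - tree_dist T x (fst p) \<in> {0..}} =
      {(v, s). (v, s) \<in> points T \<times> {0..r} \<and> tree_dist T x v \<le> s}"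
    by (auto simp: topspace_scale_space[OF T])
  ultimately have cl: "closedin ?X {(v, s). (v, s) \<in> points T \<times> {0..r} \<and> tree_dist T x v \<le> s}"
    (is "closedin _ ?C") by simp
  then have "topspace ?X - ?C \<in> sets (borel_of ?X)"
    by (auto simp: sets_borel_of closedin_def intro: sigma_sets.Basic)
  then have "topspace ?X - (topspace ?X - ?C) \<in> sets (borel_of ?X)"
    using sets.compl_sets[of "topspace ?X - ?C" "borel_of ?X"] by (simp only: space_borel_of)
  then show ?thesis using closedin_subset[OF cl] by (simp add: double_diff)
qed

lemma subtree_length_points:
  "finite_metric_tree T \<Longrightarrow> subtree_length T (points T) = total_length T"
  unfolding subtree_length_def total_length_def
proof (rule sum.cong)
  fix e assume T: "finite_metric_tree T" and e: "e \<in> edges T"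
  then have "{t \<in> {0..elen T e}. edge_point T e t \<in> points T} = {0..elen T e}"
    by (auto simp: edge_point_in_points)
  then show "measure lebesgue {t \<in> {0..elen T e}. edge_point T e t \<in> points T} = elen T e"
    using T e by (auto simp: finite_metric_tree_def less_imp_le)
qed simp

end

theory Submission
  imports Defs
begin

text \<open>
  Put \<open>L = |T|\<close>, \<open>s = \<lambda>(T)/2\<close> and \<open>b = L - \<lambda>(T)\<close>, so that \<open>s < r\<close> and, since \<open>\<lambda>(T) \<ge> L/2\<close>, also
  \<open>b \<le> 2 s\<close> and \<open>s \<ge> r/2\<close>. The law \<open>\<Lambda>\<^bsub>T,r\<^esub>\<close> is a supply of radii with density \<open>L/r\<^sup>2\<close> on \<open>[0, r]\<close>.
  The certificate spends all radii above \<open>s\<close> on balls. Each of these balls covers \<open>T\<close> once, alone or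
  together with a partner whose radius is at most \<open>s\<close>; the other small radii go into scale laws.

  Geometry. At a centroid \<open>p\<close> every branch has at most half of the length, so no decomposition beats
  the best splitting of the finitely many branches at \<open>p\<close> into two groups. Hence \<open>\<lambda>(T)\<close> is attained by
  two unions of branches at \<open>p\<close>, each of length at most \<open>2 s\<close>; and every single branch has length
  at most \<open>b\<close>, because splitting it off is a decomposition as well (\<open>optimal_split_exists\<close>). These
  two bounds limit the tripods spanned by \<open>p\<close> and two points of a piece or of a branch. They imply
  that for \<open>t \<ge> s\<close> a ball of radius \<open>t\<close> covers \<open>T\<close> if \<open>t \<ge> b\<close>, and that it covers \<open>T\<close> together
  with a ball of any radius \<open>v \<ge> 0\<close> with \<open>t + v \<ge> b\<close>. The centres move on two fixed segments as the
  radii vary (\<open>two_balls_cover\<close>).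

  Bookkeeping. Let \<open>m = max s (min b r)\<close> and \<open>u = max 0 (b - r)\<close>. A radius \<open>t \<in> (m, r]\<close> needs no partner.
  The partner of \<open>t \<in> (s, m]\<close> is its image under the decreasing affine map of \<open>[s, m]\<close> onto \<open>[u, s]\<close>;
  the sum of the two is at least \<open>b\<close> since this holds at \<open>t = s\<close> and at \<open>t = m\<close>. The partners use up the fraction
  \<open>\<rho> = (m - s)/(s - u) \<le> 1\<close> of the radii in \<open>(u, s]\<close>. The density that is left on \<open>[0, s]\<close> is
  decreasing with a single step at \<open>u\<close>, so it is exactly the sum of \<open>\<Lambda>\<^bsub>T,s\<^esub>\<close> with weight
  \<open>(1 - \<rho>) s\<^sup>2/r\<^sup>2\<close> and \<open>\<Lambda>\<^bsub>T,u\<^esub>\<close> with weight \<open>\<rho> u\<^sup>2/r\<^sup>2\<close>. Together with the coverage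
  \<open>L (r - s)/r\<^sup>2\<close> by balls this adds up to at least 1. It is exactly 1 if \<open>b \<ge> r\<close>.

  The metric facts behind the geometry are that the realization is compact, geodesic and
  0-hyperbolic. Hyperbolicity holds because every inner point of an edge is a cut point.
\<close>

section \<open>The realization as a compact geodesic space\<close>

lemma walk_imp_simple_path:
  assumes "R\<^sup>*\<^sup>* u v"
  shows "\<exists>vs. vs \<noteq> [] \<and> hd vs = u \<and> last vs = v \<and> distinct vs \<and> successively R vs"
  using assms
proof (induction rule: rtranclp_induct)
  case base
  show ?case by (rule exI[of _ "[u]"]) simp
next
  case (step y z)
  then obtain vs where vs: "vs \<noteq> []" "hd vs = u" "last vs = y" "distinct vs" "successively R vs"
    by blast
  show ?case
  proof (cases "z \<in> set vs")
    case True
    then obtain as bs where "vs = as @ z # bs" by (meson split_list)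
    then show ?thesis using vs
      by (intro exI[of _ "as @ [z]"]) (auto simp: successively_append_iff hd_append split: if_splits)
  next
    case False
    then show ?thesis using vs step(2)
      by (intro exI[of _ "vs @ [z]"]) (auto simp: successively_append_iff)
  qed
qed

locale metric_tree =
  fixes T :: "'v length_graph"
  assumes tree: "finite_metric_tree T"
begin

abbreviation X :: "'v point set" where "X \<equiv> points T"
abbreviation d :: "'v point \<Rightarrow> 'v point \<Rightarrow> real" where "d \<equiv> tree_dist T"

sublocale Metric_space X d
  by (rule Metric_space_tree[OF tree])

lemma tree_topology_eq: "tree_topology T = mtopology"
  by (simp add: tree_topology_def)

lemma elen_pos: "e \<in> edges T \<Longrightarrow> 0 < elen T e"
  using tree by (auto simp: finite_metric_tree_def)

lemma edge_ends: "e \<in> edges T \<Longrightarrow> fst e \<noteq> snd e"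
  using tree by (cases e) (auto simp: finite_metric_tree_def)

lemma vertex_in_points: "v \<in> verts T \<Longrightarrow> Vertex v \<in> X"
  by (simp add: points_def)

lemma points_cases:
  assumes "x \<in> X"
  obtains (vertex) v where "v \<in> verts T" "x = Vertex v"
    | (inner) e t where "e \<in> edges T" "0 < t" "t < elen T e" "x = Inner e t" "x = edge_point T e t"
proof -
  from assms consider v where "v \<in> verts T" "x = Vertex v"
    | e t where "e \<in> edges T" "t \<in> {0..elen T e}" "x = edge_point T e t"
    unfolding points_def by (elim UnE imageE UN_E)
  then show ?thesis
  proof cases
    case 1
    then show ?thesis by (rule vertex)
  next
    case (2 e t)
    have v: "fst e \<in> verts T" "snd e \<in> verts T"
      using tree 2 by (auto simp: finite_metric_tree_def)
    show ?thesis
    proof (cases "t = 0 \<or> t = elen T e")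
      case True
      then show ?thesis using vertex v 2 by (auto simp: edge_point_def split: if_splits)
    next
      case False
      then show ?thesis using 2 by (intro inner[of e t]) (auto simp: edge_point_def)
    qed
  qed
qed

lemma dist_le_joined:
  assumes "joined T x a y"
  shows "d x y \<le> a"
  using joined_points[OF assms] assms
  by (auto simp: tree_dist_def intro!: cInf_lower bdd_belowI[of _ 0] joined_nonneg)

lemma dist_geI:
  assumes "x \<in> X" "y \<in> X" "\<And>a. joined T x a y \<Longrightarrow> c \<le> a"
  shows "c \<le> d x y"
  using assms joined_exists[OF tree assms(1,2)] by (auto simp: tree_dist_def intro!: cInf_greatest)

lemma lipschitzI:
  fixes f :: "'v point \<Rightarrow> real"
  assumes lip: "\<And>e t t'. e \<in> edges T \<Longrightarrow> t \<in> {0..elen T e} \<Longrightarrow> t' \<in> {0..elen T e} \<Longrightarrow>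
      \<bar>f (edge_point T e t) - f (edge_point T e t')\<bar> \<le> \<bar>t - t'\<bar>"
    and "x \<in> X" "y \<in> X"
  shows "\<bar>f x - f y\<bar> \<le> d x y"
  by (intro dist_geI assms joined_lipschitz[of T f x _ y])

lemma edge_dist_le:
  "e \<in> edges T \<Longrightarrow> t \<in> {0..elen T e} \<Longrightarrow> t' \<in> {0..elen T e} \<Longrightarrow>
    d (edge_point T e t) (edge_point T e t') \<le> \<bar>t - t'\<bar>"
  by (intro dist_le_joined joined_edge)

lemma continuous_map_lipschitz_curve:
  fixes \<gamma> :: "real \<Rightarrow> 'v point"
  assumes "\<And>a. \<gamma> a \<in> X" "\<And>a b. d (\<gamma> a) (\<gamma> b) \<le> \<bar>a - b\<bar>"
  shows "continuous_map euclideanreal mtopology \<gamma>"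
  unfolding continuous_map_to_metric
proof (intro ballI allI impI)
  fix a \<epsilon> :: real assume "0 < \<epsilon>"
  then show "\<exists>U. openin euclideanreal U \<and> a \<in> U \<and> (\<forall>b\<in>U. \<gamma> b \<in> mball (\<gamma> a) \<epsilon>)"
    using assms by (intro exI[of _ "ball a \<epsilon>"])
      (auto simp: dist_real_def intro: le_less_trans[OF assms(2)])
qed

text \<open>The edge as a curve on the whole real line, constant before its start and after its end.\<close>

definition curve :: "'v \<times> 'v \<Rightarrow> real \<Rightarrow> 'v point" where
  "curve e t = edge_point T e (max 0 (min (elen T e) t))"

lemma curve_eq: "t \<in> {0..elen T e} \<Longrightarrow> curve e t = edge_point T e t"
  by (auto simp: curve_def)

lemma curve_in: "e \<in> edges T \<Longrightarrow> curve e t \<in> X"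
  unfolding curve_def using elen_pos[of e] by (intro edge_point_in_points) auto

lemma curve_dist_le: "e \<in> edges T \<Longrightarrow> d (curve e t) (curve e t') \<le> \<bar>t - t'\<bar>"
  unfolding curve_def
  by (rule order_trans[OF edge_dist_le]) (use elen_pos[of e] in \<open>auto simp: min_def max_def\<close>)

lemma continuous_map_curve: "e \<in> edges T \<Longrightarrow> continuous_map euclideanreal mtopology (curve e)"
  by (intro continuous_map_lipschitz_curve curve_in curve_dist_le)

lemma compact_space_tree: "compact_space mtopology"
proof -
  have "compactin mtopology (curve e ` {0..elen T e})" if "e \<in> edges T" for e
    by (rule image_compactin[OF _ continuous_map_curve[OF that]]) simp
  moreover have "compactin mtopology (Vertex ` verts T)"
    using tree by (intro finite_imp_compactin) (auto simp: finite_metric_tree_def vertex_in_points)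
  ultimately have "compactin mtopology (Vertex ` verts T \<union> (\<Union>e\<in>edges T. curve e ` {0..elen T e}))"
    using finite_edges[OF tree] by (intro compactin_Un compactin_Union) auto
  also have "Vertex ` verts T \<union> (\<Union>e\<in>edges T. curve e ` {0..elen T e}) = X"
  proof -
    have "curve e ` {0..elen T e} = edge_point T e ` {0..elen T e}" for e
      by (rule image_cong) (simp_all add: curve_eq)
    then show ?thesis by (simp add: points_def)
  qed
  finally show ?thesis by (simp add: compact_space_def)
qed

lemma points_nonempty: "X \<noteq> {}"
  using tree by (auto simp: finite_metric_tree_def points_def)

lemma attains_min:
  fixes h :: "'v point \<Rightarrow> real"
  assumes "continuous_map mtopology euclideanreal h" "closedin mtopology S" "S \<noteq> {}"
  shows "\<exists>w\<in>S. \<forall>z\<in>S. h w \<le> h z"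
proof -
  have "compactin mtopology S"
    using compact_space_tree assms by (simp add: closedin_compact_space)
  then have "compact (h ` S)"
    using image_compactin[OF _ assms(1)] by simp
  then show ?thesis using compact_attains_inf[of "h ` S"] assms(3) by auto
qed

lemma continuous_map_lipschitz:
  fixes h :: "'v point \<Rightarrow> real"
  assumes "\<And>x y. x \<in> X \<Longrightarrow> y \<in> X \<Longrightarrow> \<bar>h x - h y\<bar> \<le> d x y"
  shows "continuous_map mtopology euclideanreal h"
  unfolding continuous_map_from_metric
proof (intro conjI ballI allI impI)
  fix a U assume a: "a \<in> X" "openin euclideanreal U \<and> h a \<in> U"
  then obtain \<epsilon> where "0 < \<epsilon>" "ball (h a) \<epsilon> \<subseteq> U" by (auto elim: openE)
  then show "\<exists>r>0. \<forall>x. x \<in> X \<and> d a x < r \<longrightarrow> h x \<in> U"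
    using a assms[of a] by (intro exI[of _ \<epsilon>]) (force simp: dist_real_def)
qed auto

lemma dist_lipschitz: "p \<in> X \<Longrightarrow> x \<in> X \<Longrightarrow> y \<in> X \<Longrightarrow> \<bar>d p x - d p y\<bar> \<le> d x y"
  using triangle[of p x y] triangle[of p y x] commute[of x y] by linarith

lemma continuous_map_dist: "p \<in> X \<Longrightarrow> continuous_map mtopology euclideanreal (d p)"
  by (intro continuous_map_lipschitz dist_lipschitz)

lemma joined_split:
  assumes "joined T x A y" "0 \<le> a" "a \<le> A"
  shows "\<exists>w. joined T x a w \<and> joined T w (A - a) y"
  using assms
proof (induction arbitrary: a rule: joined.induct)
  case joined_refl
  then show ?case using joined.joined_refl by auto
next
  case (joined_step A e t t')
  have step: "joined T (edge_point T e t) \<bar>t - t'\<bar> (edge_point T e t')"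
    using joined_step by (intro joined_edge)
  show ?case
  proof (cases "a \<le> A")
    case True
    then obtain w where w: "joined T x a w" "joined T w (A - a) (edge_point T e t)"
      using joined_step by blast
    have "joined T w (A - a + \<bar>t - t'\<bar>) (edge_point T e t')"
      by (rule joined_trans[OF step w(2)])
    then show ?thesis using w by (auto simp: algebra_simps)
  next
    case False
    define q where "q = (if t \<le> t' then t + (a - A) else t - (a - A))"
    have q: "q \<in> {0..elen T e}" "\<bar>t - q\<bar> = a - A" "\<bar>q - t'\<bar> = A + \<bar>t - t'\<bar> - a"
      using joined_step False by (auto simp: q_def split: if_splits)
    have "joined T x (A + \<bar>t - q\<bar>) (edge_point T e q)"
      using joined_step q by (intro joined.joined_step)
    moreover have "joined T (edge_point T e q) \<bar>q - t'\<bar> (edge_point T e t')"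
      using joined_step q by (intro joined_edge)
    ultimately show ?thesis using q by auto
  qed
qed

text \<open>
  A path that is almost shortest has a point at almost the prescribed distances from both ends;
  compactness turns these points into one at the exact distances.
\<close>

lemma between:
  assumes xy: "x \<in> X" "y \<in> X" and a: "0 \<le> a" "a \<le> d x y"
  shows "\<exists>w\<in>X. d x w = a \<and> d w y = d x y - a"
proof -
  define h where "h w = max (d x w - a) (d y w - (d x y - a))" for w
  have "continuous_map mtopology euclideanreal h"
    unfolding h_def using xy dist_lipschitz
    by (intro continuous_map_lipschitz) (smt (verit))
  then obtain w where w: "w \<in> X" and min: "\<And>z. z \<in> X \<Longrightarrow> h w \<le> h z"
    using attains_min[of h X] points_nonempty by auto
  have "h w \<le> \<epsilon>" if "0 < \<epsilon>" for \<epsilon>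
  proof -
    have "\<exists>A. joined T x A y \<and> A < d x y + \<epsilon>"
      using dist_geI[OF xy, of "d x y + \<epsilon>"] \<open>0 < \<epsilon>\<close> by force
    then obtain A where A: "joined T x A y" "A < d x y + \<epsilon>" by blast
    have "a \<le> A" using a dist_le_joined[OF A(1)] by simp
    then obtain z where z: "joined T x a z" "joined T z (A - a) y"
      using joined_split A(1) a(1) by blast
    then have "z \<in> X" using joined_points by blast
    moreover have "h z \<le> \<epsilon>"
      using dist_le_joined[OF z(1)] dist_le_joined[OF z(2)] A(2) \<open>0 < \<epsilon>\<close>
      by (simp add: h_def commute)
    ultimately show ?thesis using min by force
  qed
  then have "h w \<le> 0" by (meson dense not_le)
  then show ?thesis using w triangle[of x w y] xy commute[of w y]
    by (intro bexI[of _ w]) (auto simp: h_def)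
qed

end


section \<open>Cut points and hyperbolicity\<close>

context metric_tree
begin

definition avoiding :: "'v \<times> 'v \<Rightarrow> 'v \<Rightarrow> 'v \<Rightarrow> bool" where
  "avoiding e u v \<longleftrightarrow> adjacent T u v \<and> (u, v) \<noteq> e \<and> (v, u) \<noteq> e"

text \<open>The component of \<open>fst e\<close> after the interior of the edge \<open>e\<close> is deleted.\<close>

definition start_side :: "'v \<times> 'v \<Rightarrow> 'v \<Rightarrow> bool" where
  "start_side e = (avoiding e)\<^sup>*\<^sup>* (fst e)"

lemma start_side_fst: "start_side e (fst e)"
  by (simp add: start_side_def)

text \<open>A walk joining the ends of an edge without using it would close up to a cycle.\<close>

lemma not_start_side_snd:
  assumes e: "e \<in> edges T"
  shows "\<not> start_side e (snd e)"
proof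
  assume "start_side e (snd e)"
  then have "(avoiding e)\<^sup>*\<^sup>* (fst e) (snd e)" by (simp add: start_side_def)
  from walk_imp_simple_path[OF this]
  obtain vs where vs: "vs \<noteq> []" "hd vs = fst e" "last vs = snd e" "distinct vs"
      "successively (avoiding e) vs"
    by blast
  have "3 \<le> length vs"
  proof (rule ccontr)
    assume "\<not> 3 \<le> length vs"
    moreover have "length vs \<noteq> 0" using vs(1) by simp
    ultimately have "length vs = 1 \<or> length vs = 2" by arith
    then show False
    proof
      assume "length vs = 1"
      then obtain a where "vs = [a]" by (auto simp: length_Suc_conv)
      then show False using vs(2,3) edge_ends[OF e] by simp
    next
      assume "length vs = 2"
      then obtain a b where "vs = [a, b]" by (auto simp: numeral_2_eq_2 length_Suc_conv)
      then show False using vs by (auto simp: avoiding_def)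
    qed
  qed
  moreover have "successively (adjacent T) vs"
    using vs(5) by (rule successively_mono) (simp add: avoiding_def)
  moreover have "adjacent T (last vs) (hd vs)"
    using vs e by (cases e) (auto simp: adjacent_def)
  ultimately have "graph_cycle T vs" using vs by (simp add: graph_cycle_def)
  then show False using tree by (auto simp: finite_metric_tree_def)
qed

lemma start_side_other:
  assumes e: "e \<in> edges T" and e': "e' \<in> edges T" "e' \<noteq> e"
  shows "start_side e (snd e') \<longleftrightarrow> start_side e (fst e')"
proof -
  have "(snd e', fst e') \<noteq> e"
    using e e' tree by (cases e; cases e') (auto simp: finite_metric_tree_def)
  then have "avoiding e (fst e') (snd e')" "avoiding e (snd e') (fst e')"
    using e' by (cases e'; auto simp: avoiding_def adjacent_def)+
  then show ?thesis unfolding start_side_def by (meson rtranclp.rtrancl_into_rtrancl)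
qed

text \<open>The parameter of the point of the edge \<open>e\<close> that is nearest to the given point.\<close>

fun coordinate :: "'v \<times> 'v \<Rightarrow> 'v point \<Rightarrow> real" where
  "coordinate e (Vertex v) = (if start_side e v then 0 else elen T e)"
| "coordinate e (Inner e' t) =
     (if e' = e then t else if start_side e (fst e') then 0 else elen T e)"

lemma coordinate_same: "e \<in> edges T \<Longrightarrow> coordinate e (edge_point T e t) = t"
  by (auto simp: edge_point_def start_side_fst not_start_side_snd)

lemma coordinate_other:
  "e \<in> edges T \<Longrightarrow> e' \<in> edges T \<Longrightarrow> e' \<noteq> e \<Longrightarrow>
    coordinate e (edge_point T e' t) = (if start_side e (fst e') then 0 else elen T e)"
  by (auto simp: edge_point_def start_side_other)

lemma coordinate_range: "e \<in> edges T \<Longrightarrow> x \<in> X \<Longrightarrow> coordinate e x \<in> {0..elen T e}"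
  by (erule points_cases) (use elen_pos[of e] in auto)

lemma coordinate_inner:
  assumes "e \<in> edges T" "x \<in> X" "0 < coordinate e x" "coordinate e x < elen T e"
  shows "x = edge_point T e (coordinate e x)"
  using assms(2)
  by (cases rule: points_cases) (use assms in \<open>auto split: if_splits simp: edge_point_def\<close>)

lemma coordinate_lipschitz:
  assumes "e \<in> edges T" "x \<in> X" "y \<in> X"
  shows "\<bar>coordinate e x - coordinate e y\<bar> \<le> d x y"
proof (rule lipschitzI[OF _ assms(2,3)])
  fix e' t t' assume "e' \<in> edges T"
  then show "\<bar>coordinate e (edge_point T e' t) - coordinate e (edge_point T e' t')\<bar> \<le> \<bar>t - t'\<bar>"
    using assms by (cases "e' = e") (simp_all add: coordinate_same coordinate_other)
qed

lemma edge_dist: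
  assumes "e \<in> edges T" "t \<in> {0..elen T e}" "t' \<in> {0..elen T e}"
  shows "d (edge_point T e t) (edge_point T e t') = \<bar>t - t'\<bar>"
  using coordinate_lipschitz[of e "edge_point T e t" "edge_point T e t'"] edge_dist_le[OF assms]
    assms by (simp add: coordinate_same edge_point_in_points)

text \<open>
  The distance to an inner point \<open>w\<close> of an edge, counted negatively on one side of \<open>w\<close>, is still
  1-Lipschitz on every edge, hence on the tree.
\<close>

lemma cut_point:
  assumes e: "e \<in> edges T" and s: "0 < s" "s < elen T e"
    and xy: "x \<in> X" "y \<in> X" and side: "coordinate e x \<le> s" "s \<le> coordinate e y"
  defines "w \<equiv> edge_point T e s"
  shows "d x y = d x w + d w y"
proof -
  have w: "w \<in> X" "coordinate e w = s"
    using e s by (simp_all add: w_def edge_point_in_points coordinate_same)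
  define f where "f z = (if coordinate e z \<le> s then - d z w else d z w)" for z
  have "\<bar>f x - f y\<bar> \<le> d x y"
  proof (rule lipschitzI[OF _ xy])
    fix e' t t' assume e': "e' \<in> edges T" and t: "t \<in> {0..elen T e'}" "t' \<in> {0..elen T e'}"
    let ?x = "edge_point T e' t" and ?y = "edge_point T e' t'"
    have X: "?x \<in> X" "?y \<in> X" using e' t by (simp_all add: edge_point_in_points)
    have lip: "\<bar>d ?x w - d ?y w\<bar> \<le> \<bar>t - t'\<bar>"
      using edge_dist[OF e' t] dist_lipschitz[OF w(1) X] by (simp add: commute)
    show "\<bar>f ?x - f ?y\<bar> \<le> \<bar>t - t'\<bar>"
    proof (cases "e' = e")
      case True
      then have "d ?x w = \<bar>t - s\<bar>" "d ?y w = \<bar>t' - s\<bar>"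
        using e s t by (simp_all add: w_def edge_dist)
      then show ?thesis using True e by (auto simp: f_def coordinate_same)
    next
      case False
      then show ?thesis using lip e e' by (auto simp: f_def coordinate_other)
    qed
  qed
  moreover have "f y = d y w"
  proof (cases "coordinate e y = s")
    case True
    then have "y = w" using coordinate_inner[OF e xy(2)] s by (simp add: w_def)
    then show ?thesis using w by (simp add: f_def)
  next
    case False
    then show ?thesis using side by (simp add: f_def)
  qed
  moreover have "f x = - d x w" using side by (simp add: f_def)
  ultimately show ?thesis
    using triangle[of x w y] xy w(1) nonneg[of x w] nonneg[of y w] commute[of w y] by linarith
qed

text \<open>
  If both ends lay on the same side of \<open>w\<close>, both paths to \<open>w\<close> would pass through a point of the edge
  shortly before \<open>w\<close>, and turning around there would be shorter.
\<close>

lemma between_separates: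
  assumes e: "e \<in> edges T" and s: "0 < s" "s < elen T e"
    and xy: "x \<in> X" "y \<in> X" and w: "w = edge_point T e s"
    and bet: "d x w + d w y = d x y" and ne: "x \<noteq> w" "y \<noteq> w"
  shows "coordinate e x < s \<and> s < coordinate e y \<or> coordinate e y < s \<and> s < coordinate e x"
proof -
  have wX: "w \<in> X" and cw: "coordinate e w = s"
    using e s by (simp_all add: w edge_point_in_points coordinate_same)
  have neq: "coordinate e z \<noteq> s" if "z \<in> X" "z \<noteq> w" for z
    using coordinate_inner[OF e that(1)] s that(2) by (auto simp: w)
  have no_shortcut: False
    if "0 < s'" "s' < elen T e" "s' \<noteq> s" "d w x = d w (edge_point T e s') + d (edge_point T e s') x"
      "d w y = d w (edge_point T e s') + d (edge_point T e s') y" for s'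
  proof -
    let ?w = "edge_point T e s'"
    have w': "?w \<in> X" using that e by (simp add: edge_point_in_points)
    have "0 < d w ?w" using that s e by (simp add: w edge_dist)
    then show False
      using that(4,5) bet triangle[of x ?w y] xy w' wX commute[of x w] commute[of x ?w] by linarith
  qed
  have "\<not> (coordinate e x < s \<and> coordinate e y < s)"
  proof
    assume lt: "coordinate e x < s \<and> coordinate e y < s"
    then obtain s' where s': "max (coordinate e x) (coordinate e y) < s'" "s' < s"
      using dense[of "max (coordinate e x) (coordinate e y)" s] by auto
    have "0 < s'" using s' coordinate_range[OF e xy(1)] by auto
    have "d x w = d x (edge_point T e s') + d (edge_point T e s') w"
      "d y w = d y (edge_point T e s') + d (edge_point T e s') w"
      using e s s' \<open>0 < s'\<close> xy wX cw by (intro cut_point; simp)+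
    then show False using no_shortcut[of s'] s' s \<open>0 < s'\<close> by (simp add: commute)
  qed
  moreover have "\<not> (s < coordinate e x \<and> s < coordinate e y)"
  proof
    assume lt: "s < coordinate e x \<and> s < coordinate e y"
    then obtain s' where s': "s < s'" "s' < min (coordinate e x) (coordinate e y)"
      using dense[of s "min (coordinate e x) (coordinate e y)"] by auto
    have "s' < elen T e" using s' coordinate_range[OF e xy(1)] by auto
    have "d w x = d w (edge_point T e s') + d (edge_point T e s') x"
      "d w y = d w (edge_point T e s') + d (edge_point T e s') y"
      using e s s' \<open>s' < elen T e\<close> xy wX cw by (intro cut_point; simp)+
    then show False using no_shortcut[of s'] s' s \<open>s' < elen T e\<close> by simp
  qed
  ultimately show ?thesis using neq[OF xy(1) ne(1)] neq[OF xy(2) ne(2)] by linarith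
qed

text \<open>
  The Gromov product. In a tree it is the depth, seen from \<open>p\<close>, at which the paths to \<open>x\<close> and to \<open>y\<close>
  separate.
\<close>

definition gp :: "'v point \<Rightarrow> 'v point \<Rightarrow> 'v point \<Rightarrow> real" where
  "gp p x y = (d p x + d p y - d x y) / 2"

lemma gp_commute: "gp p x y = gp p y x"
  by (simp add: gp_def commute)

lemma gp_nonneg: "p \<in> X \<Longrightarrow> x \<in> X \<Longrightarrow> y \<in> X \<Longrightarrow> 0 \<le> gp p x y"
  using triangle[of x p y] by (simp add: gp_def commute)

lemma gp_le: "p \<in> X \<Longrightarrow> x \<in> X \<Longrightarrow> y \<in> X \<Longrightarrow> gp p x y \<le> d p x"
  using triangle[of p x y] by (simp add: gp_def commute)

lemma gp_self: "x \<in> X \<Longrightarrow> gp p x x = d p x"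
  by (simp add: gp_def)

text \<open>
  Between \<open>p\<close> and \<open>y\<close>, at a generic distance from \<open>p\<close> below both Gromov products on the left, lies an
  inner point of an edge. It cuts \<open>p\<close> off from \<open>y\<close>, and it must cut \<open>p\<close> off from \<open>x\<close> and \<open>z\<close> too, so
  the paths from \<open>p\<close> to \<open>x\<close> and to \<open>z\<close> agree up to it.
\<close>

lemma hyperbolic:
  assumes X: "p \<in> X" "x \<in> X" "y \<in> X" "z \<in> X"
  shows "min (gp p x y) (gp p y z) \<le> gp p x z"
proof (rule ccontr)
  assume "\<not> ?thesis"
  then have lt: "gp p x z < min (gp p x y) (gp p y z)" by (rule not_le_imp_less)
  have "infinite ({gp p x z<..<min (gp p x y) (gp p y z)} - (\<lambda>v. d p (Vertex v)) ` verts T)"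
    using infinite_Ioo[OF lt] tree by (intro Diff_infinite_finite) (auto simp: finite_metric_tree_def)
  then obtain a where a: "gp p x z < a" "a < gp p x y" "a < gp p y z"
      "a \<notin> (\<lambda>v. d p (Vertex v)) ` verts T"
    using not_finite_existsD by (auto dest!: infinite_imp_nonempty)
  have a0: "0 < a" "a < d p y"
    using a gp_nonneg[of p x z] gp_le[of p y x] X by (auto simp: gp_commute)
  then obtain w where w: "w \<in> X" "d p w = a" "d w y = d p y - a"
    using between[of p y a] X by auto
  obtain e s where e: "e \<in> edges T" "0 < s" "s < elen T e" "w = edge_point T e s"
    using w(1) by (cases rule: points_cases) (use a(4) w(2) in auto)
  have sep: "coordinate e p < s \<and> s < coordinate e y \<or> coordinate e y < s \<and> s < coordinate e p"
    using a0 w X by (intro between_separates[OF e(1-3) _ _ e(4)]) auto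
  have beyond: "d p v = a + d w v" if v: "v \<in> X" "a < gp p v y" for v
  proof -
    have "\<not> (d v y = d v w + d w y)"
      using v w triangle[of p w v] X by (auto simp: gp_def commute)
    moreover have "d v y = d v w + d w y \<or> d p v = d p w + d w v"
    proof (cases "coordinate e p < s \<longleftrightarrow> coordinate e v \<le> s")
      case True
      then have "coordinate e v \<le> s \<and> s \<le> coordinate e y \<or> coordinate e y \<le> s \<and> s \<le> coordinate e v"
        using sep by linarith
      then have "d v y = d v w + d w y \<or> d y v = d y w + d w v"
        unfolding e(4) using cut_point[OF e(1-3)] v(1) X by blast
      then show ?thesis by (auto simp: commute)
    next
      case False
      then have "coordinate e p \<le> s \<and> s \<le> coordinate e v \<or> coordinate e v \<le> s \<and> s \<le> coordinate e p"
        using sep by linarith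
      then have "d p v = d p w + d w v \<or> d v p = d v w + d w p"
        unfolding e(4) using cut_point[OF e(1-3)] v(1) X by blast
      then show ?thesis by (auto simp: commute)
    qed
    ultimately show ?thesis using w by simp
  qed
  have "d p x = a + d w x" "d p z = a + d w z"
    using beyond[of x] beyond[of z] X a by (auto simp: gp_commute)
  then show False using a(1) triangle[of x w z] X w(1) by (simp add: gp_def commute)
qed

end


section \<open>Geodesic segments and branches\<close>

context metric_tree
begin

definition seg :: "'v point \<Rightarrow> 'v point \<Rightarrow> 'v point set" where
  "seg x y = {z \<in> X. d x z + d z y = d x y}"

lemma seg_subset: "seg x y \<subseteq> X"
  by (auto simp: seg_def)

lemma end_in_seg: "x \<in> X \<Longrightarrow> y \<in> X \<Longrightarrow> x \<in> seg x y" "x \<in> X \<Longrightarrow> y \<in> X \<Longrightarrow> y \<in> seg x y"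
  by (simp_all add: seg_def)

lemma gp_in_seg: "w \<in> seg p x \<Longrightarrow> gp p x w = d p w"
  by (auto simp: seg_def gp_def commute)

lemma in_seg_iff_gp: "p \<in> X \<Longrightarrow> x \<in> X \<Longrightarrow> w \<in> X \<Longrightarrow> w \<in> seg p x \<longleftrightarrow> gp p x w = d p w"
  by (auto simp: seg_def gp_def commute)

text \<open>
  The paths from \<open>p\<close> to \<open>x\<close> and to \<open>z\<close> separate at depth \<open>gp p x z\<close>; the path to a point \<open>w\<close> of the
  former leaves the latter there or stays on it.
\<close>

lemma gp_seg:
  assumes "p \<in> X" "x \<in> X" "z \<in> X" and w: "w \<in> seg p x"
  shows "gp p w z = min (d p w) (gp p x z)"
proof -
  have X: "w \<in> X" using w by (simp add: seg_def)
  have eq: "gp p x w = d p w" using gp_in_seg[OF w] .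
  have "min (gp p w x) (gp p x z) \<le> gp p w z" "min (gp p x w) (gp p w z) \<le> gp p x z"
    using hyperbolic assms X by blast+
  moreover have "gp p w z \<le> d p w" using gp_le assms X by blast
  ultimately show ?thesis using eq by (auto simp: gp_commute)
qed

lemma dist_eq_gp: "d x y = d p x + d p y - 2 * gp p x y"
  by (simp add: gp_def field_simps)

lemma seg_point:
  assumes "x \<in> X" "y \<in> X" "0 \<le> a" "a \<le> d x y"
  obtains w where "w \<in> seg x y" "d x w = a"
proof -
  obtain w where "w \<in> X" "d x w = a" "d w y = d x y - a" using between[OF assms] by blast
  then show thesis by (intro that[of w]) (simp_all add: seg_def)
qed

lemma geodesic_exists:
  assumes X: "p \<in> X" "x \<in> X"
  shows "\<exists>\<gamma>. (\<forall>a. \<gamma> a \<in> seg p x) \<and> (\<forall>a\<in>{0..d p x}. d p (\<gamma> a) = a) \<and>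
    (\<forall>a b. d (\<gamma> a) (\<gamma> b) \<le> \<bar>a - b\<bar>)"
proof -
  define cl where "cl a = max 0 (min (d p x) a)" for a
  have "\<exists>w. w \<in> seg p x \<and> d p w = cl a" for a
    using seg_point[OF X, of "cl a"] by (auto simp: cl_def)
  then obtain \<gamma> where \<gamma>: "\<And>a. \<gamma> a \<in> seg p x" "\<And>a. d p (\<gamma> a) = cl a" by metis
  have "d (\<gamma> a) (\<gamma> b) \<le> \<bar>a - b\<bar>" for a b
  proof -
    have "\<gamma> b \<in> X" using \<gamma>(1) seg_subset by blast
    then have "gp p (\<gamma> a) (\<gamma> b) = min (cl a) (cl b)"
      using gp_seg[OF X _ \<gamma>(1)[of a], of "\<gamma> b"] gp_in_seg[OF \<gamma>(1)] by (simp add: \<gamma>(2))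
    then have "d (\<gamma> a) (\<gamma> b) = \<bar>cl a - cl b\<bar>"
      using dist_eq_gp[of "\<gamma> a" "\<gamma> b" p] by (simp add: \<gamma>(2) min_def)
    also have "\<dots> \<le> \<bar>a - b\<bar>"
      unfolding cl_def using nonneg[of p x] by linarith
    finally show ?thesis .
  qed
  then show ?thesis using \<gamma> by (intro exI[of _ \<gamma>]) (auto simp: cl_def)
qed

lemma connectedin_seg:
  assumes X: "p \<in> X" "x \<in> X"
  shows "connectedin mtopology (seg p x)"
proof -
  obtain \<gamma> where \<gamma>: "\<And>a. \<gamma> a \<in> seg p x" "\<And>a. a \<in> {0..d p x} \<Longrightarrow> d p (\<gamma> a) = a"
      "\<And>a b. d (\<gamma> a) (\<gamma> b) \<le> \<bar>a - b\<bar>"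
    using geodesic_exists[OF X] by blast
  have "seg p x = range \<gamma>"
  proof
    show "seg p x \<subseteq> range \<gamma>"
    proof
      fix w assume w: "w \<in> seg p x"
      then have wX: "w \<in> X" and eq: "d p w + d w x = d p x" by (auto simp: seg_def)
      have le: "d p w \<le> d p x" using eq nonneg[of w x] by linarith
      let ?v = "\<gamma> (d p w)"
      have v: "?v \<in> seg p x" "d p ?v = d p w" using \<gamma> le by auto
      have "?v \<in> X" using v seg_subset by blast
      have "gp p ?v w = d p w" using gp_seg[OF X wX v(1)] gp_in_seg[OF w] v(2) by simp
      then have "d ?v w = 0" using v(2) by (simp add: gp_def)
      then have "?v = w" using \<open>?v \<in> X\<close> wX by simp
      then show "w \<in> range \<gamma>" by (metis rangeI)
    qed
  qed (use \<gamma> in auto)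
  moreover have "continuous_map euclideanreal mtopology \<gamma>"
    using \<gamma>(1,3) seg_subset by (intro continuous_map_lipschitz_curve) blast+
  ultimately show ?thesis
    using connectedin_continuous_map_image[of euclideanreal mtopology \<gamma> UNIV] by simp
qed

text \<open>Two points different from \<open>p\<close> lie in the same branch at \<open>p\<close> if their Gromov product is positive.\<close>

definition branch :: "'v point \<Rightarrow> 'v point \<Rightarrow> 'v point set" where
  "branch p x = {y \<in> X. 0 < gp p x y}"

lemma branch_subset: "branch p x \<subseteq> X"
  by (auto simp: branch_def)

lemma branch_trans:
  assumes "p \<in> X" "x \<in> X" "y \<in> X" "z \<in> X" "0 < gp p x y" "0 < gp p y z"
  shows "0 < gp p x z"
  using hyperbolic[OF assms(1-4)] assms(5,6) by linarith

lemma openin_branch_invariant: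
  assumes p: "p \<in> X" and A: "A \<subseteq> X - {p}"
    and inv: "\<And>x y. x \<in> A \<Longrightarrow> y \<in> X \<Longrightarrow> 0 < gp p x y \<Longrightarrow> y \<in> A"
  shows "openin mtopology A"
  unfolding openin_mtopology
proof (intro conjI allI impI)
  show "A \<subseteq> X" using A by blast
next
  fix x assume x: "x \<in> A"
  have "mball x (d p x) \<subseteq> A"
  proof
    fix y assume "y \<in> mball x (d p x)"
    then show "y \<in> A" using inv[OF x, of y] p nonneg[of p y] by (auto simp: gp_def)
  qed
  moreover have "0 < d p x" using x A p by (auto simp: mdist_pos_less)
  ultimately show "\<exists>r>0. mball x r \<subseteq> A" by blast
qed

lemma openin_branch:
  assumes X: "p \<in> X" "x \<in> X"
  shows "openin mtopology (branch p x)"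
proof (rule openin_branch_invariant[OF X(1)])
  show "branch p x \<subseteq> X - {p}" using X gp_le[of p p x] by (auto simp: branch_def gp_commute)
  show "v \<in> branch p x" if "u \<in> branch p x" "v \<in> X" "0 < gp p u v" for u v
    using that X branch_trans[of p x u v] by (auto simp: branch_def)
qed

text \<open>
  These sets and their opposites \<open>insert p (X - S)\<close> are exactly the pieces of the two-piece
  decompositions that meet at \<open>p\<close>.
\<close>

definition branch_union :: "'v point \<Rightarrow> 'v point set \<Rightarrow> bool" where
  "branch_union p S \<longleftrightarrow> p \<in> S \<and> S \<subseteq> X \<and> (\<forall>x\<in>S. branch p x \<subseteq> S)"

lemma branch_unionD: "branch_union p S \<Longrightarrow> x \<in> S \<Longrightarrow> y \<in> X \<Longrightarrow> 0 < gp p x y \<Longrightarrow> y \<in> S"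
  by (auto simp: branch_union_def branch_def)

lemma branch_union_opposite:
  assumes "branch_union p S"
  shows "branch_union p (insert p (X - S))"
proof -
  have p: "p \<in> X" using assms by (auto simp: branch_union_def)
  have "y \<notin> S \<or> x \<in> S" if "x \<in> X" "0 < gp p x y" for x y
    using branch_unionD[OF assms, of y x] that by (auto simp: gp_commute)
  moreover have "gp p p y = 0" for y using p by (simp add: gp_def)
  ultimately show ?thesis using p by (auto simp: branch_union_def branch_def)
qed

lemma branch_union_insert_branch:
  assumes "p \<in> X" "x \<in> X"
  shows "branch_union p (insert p (branch p x))"
proof -
  have "gp p p y = 0" for y using assms by (simp add: gp_def)
  moreover have "z \<in> branch p x" if "y \<in> branch p x" "z \<in> branch p y" for y z
    using that assms branch_trans[of p x y z] by (simp add: branch_def)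
  ultimately show ?thesis using assms by (auto simp: branch_union_def branch_def)
qed

lemma closedin_branch_union:
  assumes "branch_union p S"
  shows "closedin mtopology S"
proof -
  have S: "p \<in> X" "S \<subseteq> X" "p \<in> S" using assms by (auto simp: branch_union_def)
  have "openin mtopology (X - S)"
  proof (rule openin_branch_invariant[OF S(1)])
    show "X - S \<subseteq> X - {p}" using S by blast
    show "y \<in> X - S" if "x \<in> X - S" "y \<in> X" "0 < gp p x y" for x y
      using branch_unionD[OF assms, of y x] that by (auto simp: gp_commute)
  qed
  then show ?thesis using S by (simp add: closedin_def)
qed

lemma seg_subset_branch_union:
  assumes S: "branch_union p S" and x: "x \<in> S"
  shows "seg p x \<subseteq> S"
proof
  fix w assume w: "w \<in> seg p x"
  have X: "p \<in> X" "x \<in> X" "w \<in> X" and p: "p \<in> S"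
    using S x w by (auto simp: branch_union_def seg_def)
  show "w \<in> S"
  proof (cases "w = p")
    case False
    then have "0 < gp p x w" using gp_in_seg[OF w] X by (simp add: mdist_pos_less)
    then show ?thesis using branch_unionD[OF S x] X by blast
  qed (use p in simp)
qed

lemma metric_subtree_branch_union:
  assumes S: "branch_union p S"
  shows "metric_subtree T S"
proof -
  have p: "p \<in> S" "S \<subseteq> X" using S by (auto simp: branch_union_def)
  have "S = (\<Union>x\<in>S. seg p x)"
  proof
    show "S \<subseteq> (\<Union>x\<in>S. seg p x)" using end_in_seg(2)[of p] p by blast
  qed (use seg_subset_branch_union[OF S] in blast)
  moreover have "connectedin mtopology (\<Union>x\<in>S. seg p x)"
  proof (rule connectedin_Union)
    show "connectedin mtopology U" if "U \<in> seg p ` S" for U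
      using that p connectedin_seg by blast
    have "p \<in> \<Inter> (seg p ` S)" using p end_in_seg(1) by blast
    then show "\<Inter> (seg p ` S) \<noteq> {}" by blast
  qed
  ultimately show ?thesis
    using closedin_branch_union[OF S] p by (auto simp: metric_subtree_def tree_topology_eq)
qed

text \<open>A point inside a segment separates its ends, since the branches at that point are open.\<close>

lemma connectedin_imp_convex:
  assumes S: "connectedin mtopology S" and xy: "x \<in> S" "y \<in> S"
  shows "seg x y \<subseteq> S"
proof
  fix z assume z: "z \<in> seg x y"
  have SX: "S \<subseteq> X" using connectedin_subset_topspace[OF S] by simp
  then have X: "x \<in> X" "y \<in> X" "z \<in> X" using xy z by (auto simp: seg_def)
  show "z \<in> S"
  proof (rule ccontr)
    assume nz: "z \<notin> S"
    define V where "V = X - {z} - branch z x"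
    have "openin mtopology (branch z x)" using X by (intro openin_branch)
    moreover have "openin mtopology V"
    proof (rule openin_branch_invariant[OF X(3)])
      show "v \<in> V" if "u \<in> V" "v \<in> X" "0 < gp z u v" for u v
        using that X branch_trans[of z x v u] gp_le[of z z u]
        by (auto simp: branch_def V_def gp_commute)
    qed (auto simp: V_def)
    moreover have "x \<in> branch z x"
      using X nz xy by (auto simp: branch_def gp_self mdist_pos_less)
    moreover have "y \<in> V"
      using X nz xy z by (auto simp: V_def branch_def gp_def seg_def commute)
    moreover have "S \<subseteq> branch z x \<union> V" "branch z x \<inter> V = {}"
      using SX nz by (auto simp: V_def)
    ultimately show False
      using S xy unfolding connectedin by blast
  qed
qed

text \<open>
  Otherwise the paths from \<open>q\<close> to \<open>x\<close> and to \<open>y\<close> would share a point other than \<open>q\<close>, and by convexity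
  it would lie in both pieces.
\<close>

lemma gp_across_pieces:
  assumes S: "connectedin mtopology S" "connectedin mtopology S'" "S \<inter> S' = {q}"
    and xy: "x \<in> S" "y \<in> S'"
  shows "gp q x y = 0"
proof (rule ccontr)
  assume ne: "gp q x y \<noteq> 0"
  have X: "q \<in> X" "x \<in> X" "y \<in> X" and q: "q \<in> S" "q \<in> S'"
    using S xy connectedin_subset_topspace by fastforce+
  have k: "0 < gp q x y" "gp q x y \<le> d q x" "gp q x y \<le> d q y"
    using ne gp_nonneg[OF X] gp_le[OF X] gp_le[of q y x] X by (auto simp: gp_commute)
  obtain w where w: "w \<in> seg q x" "d q w = gp q x y"
    using seg_point[OF X(1,2)] k by (metis less_imp_le)
  have wX: "w \<in> X" using w seg_subset by blast
  have "gp q y w = d q w" using gp_seg[OF X w(1)] w(2) by (simp add: gp_commute)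
  then have "w \<in> seg q y" using X wX by (simp add: in_seg_iff_gp)
  then have "w \<in> S \<inter> S'" using connectedin_imp_convex S xy q w by blast
  then have "w = q" using S by simp
  then show False using w(2) k(1) X by simp
qed

end


section \<open>The length measure\<close>

lemma continuous_map_measurable_borel_of:
  assumes "continuous_map euclideanreal Y f"
  shows "f \<in> measurable borel (borel_of Y)"
  unfolding borel_of_def
proof (rule measurable_measure_of)
  show "f -` U \<inter> space borel \<in> sets borel" if "U \<in> {U. openin Y U}" for U
    using openin_continuous_map_preimage[OF assms, of U] that by (simp add: vimage_def)
qed (use assms openin_subset in \<open>auto simp: continuous_map_def\<close>)

lemma openin_in_borel_of: "openin Y U \<Longrightarrow> U \<in> sets (borel_of Y)"
  by (auto simp: sets_borel_of intro: sigma_sets.Basic)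

lemma closedin_in_borel_of: "closedin Y U \<Longrightarrow> U \<in> sets (borel_of Y)"
  using sets.compl_sets[of "topspace Y - U" "borel_of Y"] closedin_subset[of Y U]
  by (simp add: space_borel_of openin_in_borel_of closedin_def double_diff)

lemma measure_lipschitz_image_le:
  fixes h :: "real \<Rightarrow> real"
  assumes "a \<le> b" and lip: "\<And>s t. \<bar>h s - h t\<bar> \<le> \<bar>s - t\<bar>"
  shows "h ` {a..b} \<in> lmeasurable" "measure lebesgue (h ` {a..b}) \<le> b - a"
proof -
  have "continuous_on {a..b} h"
    unfolding continuous_on_iff dist_real_def using lip by (meson le_less_trans)
  then have "compact (h ` {a..b})" "connected (h ` {a..b})"
    by (auto intro: compact_continuous_image connected_continuous_image)
  then obtain u v where uv: "h ` {a..b} = {u..v}"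
    using connected_compact_interval_1 by blast
  then have "u \<le> v" using assms(1) by (metis atLeastatMost_empty_iff image_is_empty)
  then obtain s t where "s \<in> {a..b}" "t \<in> {a..b}" "h s = u" "h t = v"
    using uv by (metis atLeastAtMost_iff imageE order_refl)
  then have "v - u \<le> b - a" using lip[of s t] by auto
  then show "h ` {a..b} \<in> lmeasurable" "measure lebesgue (h ` {a..b}) \<le> b - a"
    using \<open>u \<le> v\<close> by (simp_all add: uv)
qed

context metric_tree
begin

abbreviation len :: "'v point set \<Rightarrow> real" where "len \<equiv> subtree_length T"
abbreviation borel_sets :: "'v point set set" where "borel_sets \<equiv> sets (borel_of mtopology)"

definition slice :: "'v \<times> 'v \<Rightarrow> 'v point set \<Rightarrow> real set" where
  "slice e S = {t \<in> {0..elen T e}. edge_point T e t \<in> S}"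

lemma len_eq: "len S = (\<Sum>e\<in>edges T. measure lebesgue (slice e S))"
  by (simp add: subtree_length_def slice_def)

lemma slice_eq_vimage: "slice e S = {0..elen T e} \<inter> (curve e -` S)"
  by (auto simp: slice_def curve_eq)

lemma slice_lmeasurable:
  assumes "e \<in> edges T" "S \<in> borel_sets"
  shows "slice e S \<in> lmeasurable"
proof -
  have "curve e \<in> measurable borel (borel_of mtopology)"
    by (rule continuous_map_measurable_borel_of[OF continuous_map_curve[OF assms(1)]])
  then have "curve e -` S \<in> sets borel"
    using measurable_sets[of "curve e" borel "borel_of mtopology" S] assms(2) by simp
  then have "curve e -` S \<in> sets lebesgue" by simp
  then show ?thesis
    unfolding slice_eq_vimage by (intro fmeasurable_Int_fmeasurable) auto
qed

lemma len_mono: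
  assumes "S \<subseteq> S'" "S \<in> borel_sets" "S' \<in> borel_sets"
  shows "len S \<le> len S'"
  unfolding len_eq
proof (rule sum_mono)
  fix e assume e: "e \<in> edges T"
  have "slice e S \<subseteq> slice e S'" using assms(1) by (auto simp: slice_def)
  then show "measure lebesgue (slice e S) \<le> measure lebesgue (slice e S')"
    using slice_lmeasurable[OF e] assms by (intro measure_mono_fmeasurable fmeasurableD)
qed

lemma len_Un_disjoint:
  assumes "S \<in> borel_sets" "S' \<in> borel_sets" "S \<inter> S' = {}"
  shows "len (S \<union> S') = len S + len S'"
proof -
  have "measure lebesgue (slice e (S \<union> S')) = measure lebesgue (slice e S) + measure lebesgue (slice e S')"
    if "e \<in> edges T" for e
  proof -
    have "slice e (S \<union> S') = slice e S \<union> slice e S'" "slice e S \<inter> slice e S' = {}"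
      using assms(3) by (auto simp: slice_def)
    then show ?thesis
      using slice_lmeasurable[OF that] assms by (simp add: measure_Un3)
  qed
  then show ?thesis by (simp add: len_eq sum.distrib)
qed

lemma len_singleton: "len {p} = 0"
proof -
  have "measure lebesgue (slice e {p}) = 0" if "e \<in> edges T" for e
  proof -
    have "t = t'" if "t \<in> slice e {p}" "t' \<in> slice e {p}" for t t'
      using that coordinate_same[OF \<open>e \<in> edges T\<close>] by (auto simp: slice_def) metis
    then have "slice e {p} = {} \<or> (\<exists>t. slice e {p} = {t})" by blast
    then show ?thesis by auto
  qed
  then show ?thesis by (simp add: len_eq)
qed

lemma borel_singleton: "p \<in> X \<Longrightarrow> {p} \<in> borel_sets"
  by (intro closedin_in_borel_of) (simp add: closedin_Hausdorff_singleton Hausdorff_space_mtopology)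

lemma len_Un_point:
  assumes "S \<in> borel_sets" "S' \<in> borel_sets" "S \<inter> S' = {p}"
  shows "len (S \<union> S') = len S + len S'"
proof -
  have p: "p \<in> X" using assms sets.sets_into_space[OF assms(1)] by (auto simp: space_borel_of)
  then have b: "{p} \<in> borel_sets" by (rule borel_singleton)
  then have "S' - {p} \<in> borel_sets" using assms by auto
  moreover have "S' = S' - {p} \<union> {p}" using assms by blast
  ultimately have "len S' = len (S' - {p})"
    using len_Un_disjoint[of "S' - {p}" "{p}"] b by (simp add: len_singleton)
  moreover have "len (S \<union> (S' - {p})) = len S + len (S' - {p})"
    using assms \<open>S' - {p} \<in> borel_sets\<close> by (intro len_Un_disjoint) auto
  moreover have "S \<union> (S' - {p}) = S \<union> S'" using assms by blast
  ultimately show ?thesis by simp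
qed

lemma X_in_borel_sets: "X \<in> borel_sets"
  by (intro openin_in_borel_of) simp

lemma len_X: "len X = total_length T"
  by (rule subtree_length_points[OF tree])

lemma len_Diff: "S \<in> borel_sets \<Longrightarrow> len (X - S) = total_length T - len S"
  using len_Un_disjoint[of S "X - S"] X_in_borel_sets sets.sets_into_space[of S "borel_of mtopology"]
  by (simp add: len_X space_borel_of Un_absorb1)

lemma len_LIMSEQ_incseq:
  assumes "\<And>n. S n \<in> borel_sets" "incseq S"
  shows "(\<lambda>n. len (S n)) \<longlonglongrightarrow> len (\<Union>n. S n)"
  unfolding len_eq
proof (intro tendsto_sum)
  fix e assume e: "e \<in> edges T"
  have eq: "slice e (\<Union>n. S n) = (\<Union>n. slice e (S n))" by (auto simp: slice_def)
  have "(\<Union>n. S n) \<in> borel_sets" using assms(1) by auto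
  then have "(\<Union>n. slice e (S n)) \<in> lmeasurable"
    using slice_lmeasurable[OF e] eq by metis
  then show "(\<lambda>n. measure lebesgue (slice e (S n))) \<longlonglongrightarrow> measure lebesgue (slice e (\<Union>n. S n))"
    unfolding eq using assms slice_lmeasurable[OF e]
    by (intro Lim_measure_incseq) (auto simp: incseq_def slice_def fmeasurable_def; blast)+
qed

lemma len_LIMSEQ_decseq:
  assumes "\<And>n. S n \<in> borel_sets" "decseq S"
  shows "(\<lambda>n. len (S n)) \<longlonglongrightarrow> len (\<Inter>n. S n)"
proof -
  have "(\<lambda>n. len (X - S n)) \<longlonglongrightarrow> len (\<Union>n. X - S n)"
    using assms X_in_borel_sets by (intro len_LIMSEQ_incseq) (auto simp: decseq_def incseq_def)
  moreover have "(\<Union>n. X - S n) = X - (\<Inter>n. S n)" by blast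
  moreover have "(\<Inter>n. S n) \<in> borel_sets" using assms(1) by auto
  ultimately have "(\<lambda>n. total_length T - len (S n)) \<longlonglongrightarrow> total_length T - len (\<Inter>n. S n)"
    using assms(1) by (simp add: len_Diff)
  from tendsto_diff[OF tendsto_const[of "total_length T"] this] show ?thesis by simp
qed

lemma seg_closed: "x \<in> X \<Longrightarrow> y \<in> X \<Longrightarrow> closedin mtopology (seg x y)"
proof -
  assume xy: "x \<in> X" "y \<in> X"
  have "continuous_map mtopology euclideanreal (\<lambda>z. d x z + d y z)"
    by (intro continuous_map_add continuous_map_dist xy)
  then have "closedin mtopology {z \<in> topspace mtopology. d x z + d y z \<in> {d x y}}"
    by (rule closedin_continuous_map_preimage) simp
  then show ?thesis by (simp add: seg_def commute)
qed

lemma seg_borel: "x \<in> X \<Longrightarrow> y \<in> X \<Longrightarrow> seg x y \<in> borel_sets"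
  by (intro closedin_in_borel_of seg_closed)

text \<open>
  The distance from \<open>x\<close> maps the segment onto an interval of length \<open>d x y\<close>. It does not increase
  lengths, and the segment meets every edge in an interval.
\<close>

lemma dist_le_len_seg:
  assumes X: "x \<in> X" "y \<in> X"
  shows "d x y \<le> len (seg x y)"
proof -
  have slice_interval: "\<exists>a b. slice e (seg x y) = {a..b}" if e: "e \<in> edges T" for e
  proof -
    have "compact ({0..elen T e} \<inter> curve e -` seg x y)"
    proof (rule compact_Int_closed)
      show "closed (curve e -` seg x y)"
        using closedin_continuous_map_preimage[OF continuous_map_curve[OF e] seg_closed[OF X]]
        by (simp add: vimage_def)
    qed simp
    moreover have "is_interval (slice e (seg x y))"
      unfolding is_interval_1
    proof (intro ballI allI impI, elim conjE)
      fix a b t assume ab: "a \<in> slice e (seg x y)" "b \<in> slice e (seg x y)" "a \<le> t" "t \<le> b"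
      then have "edge_point T e t \<in> seg (edge_point T e a) (edge_point T e b)"
        using e edge_dist[of e] by (auto simp: slice_def seg_def edge_point_in_points)
      moreover have "seg (edge_point T e a) (edge_point T e b) \<subseteq> seg x y"
        using ab by (intro connectedin_imp_convex connectedin_seg X) (auto simp: slice_def)
      ultimately show "t \<in> slice e (seg x y)" using ab by (auto simp: slice_def)
    qed
    ultimately show ?thesis
      using is_interval_compact[of "slice e (seg x y)"] by (simp add: slice_eq_vimage)
  qed
  define V where "V e = d x ` edge_point T e ` slice e (seg x y)" for e
  have V: "V e \<in> lmeasurable \<and> measure lebesgue (V e) \<le> measure lebesgue (slice e (seg x y))"
    if e: "e \<in> edges T" for e
  proof -
    obtain a b where ab: "slice e (seg x y) = {a..b}" using slice_interval[OF e] by blast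
    show ?thesis
    proof (cases "a \<le> b")
      case True
      have sub: "{a..b} \<subseteq> {0..elen T e}" unfolding ab[symmetric] by (auto simp: slice_def)
      have "edge_point T e t = curve e t" if "t \<in> {a..b}" for t
        by (rule curve_eq[symmetric, OF subsetD[OF sub that]])
      then have "V e = (\<lambda>t. d x (curve e t)) ` {a..b}"
        unfolding V_def image_image ab by (intro image_cong refl) simp
      moreover have "\<bar>d x (curve e s) - d x (curve e t)\<bar> \<le> \<bar>s - t\<bar>" for s t
        by (rule order_trans[OF dist_lipschitz curve_dist_le]) (simp_all add: X e curve_in)
      ultimately show ?thesis
        using measure_lipschitz_image_le[OF True, of "\<lambda>t. d x (curve e t)"] True by (simp add: ab)
    next
      case False
      then show ?thesis by (simp add: V_def ab)
    qed
  qed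
  have "{0..d x y} \<subseteq> (\<Union>e\<in>edges T. V e) \<union> (\<lambda>v. d x (Vertex v)) ` verts T"
  proof
    fix a assume "a \<in> {0..d x y}"
    then obtain w where w: "w \<in> seg x y" "d x w = a" using seg_point[OF X] by auto
    then have "w \<in> X" using seg_subset by blast
    then show "a \<in> (\<Union>e\<in>edges T. V e) \<union> (\<lambda>v. d x (Vertex v)) ` verts T"
    proof (cases rule: points_cases)
      case (inner e t)
      then have "t \<in> slice e (seg x y)" using w by (auto simp: slice_def)
      moreover have "a = d x (edge_point T e t)" using w(2) inner(5) by simp
      ultimately have "a \<in> V e" unfolding V_def by blast
      then show ?thesis using inner(1) by blast
    qed (use w in auto)
  qed
  moreover have fin: "finite ((\<lambda>v. d x (Vertex v)) ` verts T)"
    using tree by (simp add: finite_metric_tree_def)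
  moreover have fm: "(\<lambda>v. d x (Vertex v)) ` verts T \<in> lmeasurable"
    using fin by (intro lmeasurable_compact finite_imp_compact)
  moreover have VU: "(\<Union>e\<in>edges T. V e) \<in> lmeasurable"
    using V finite_edges[OF tree] by (intro fmeasurable.finite_UN) auto
  ultimately have "measure lebesgue {0..d x y} \<le>
      measure lebesgue ((\<Union>e\<in>edges T. V e) \<union> (\<lambda>v. d x (Vertex v)) ` verts T)"
    by (intro measure_mono_fmeasurable fmeasurable.Un) auto
  also have "\<dots> \<le> measure lebesgue (\<Union>e\<in>edges T. V e) + measure lebesgue ((\<lambda>v. d x (Vertex v)) ` verts T)"
    using fm VU by (intro measure_Un_le fmeasurableD)
  also have "measure lebesgue ((\<lambda>v. d x (Vertex v)) ` verts T) = 0"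
    using negligible_finite[OF fin] by (simp add: negligible_imp_measure0)
  also have "measure lebesgue (\<Union>e\<in>edges T. V e) \<le> (\<Sum>e\<in>edges T. measure lebesgue (V e))"
    using V finite_edges[OF tree] by (intro measure_UNION_le) auto
  also have "\<dots> \<le> len (seg x y)"
    unfolding len_eq using V by (intro sum_mono) auto
  finally show ?thesis by simp
qed

text \<open>
  The left-hand side is the length of the tripod spanned by \<open>p\<close>, \<open>x\<close> and \<open>y\<close>: it consists of the segment
  from \<open>p\<close> to \<open>x\<close> and the part of the segment from \<open>p\<close> to \<open>y\<close> after the point \<open>m\<close> where they separate.
\<close>

lemma tripod_le_len:
  assumes S: "closedin mtopology S" and xy: "x \<in> S" "y \<in> S" and p: "p \<in> S"
    and star: "\<And>z. z \<in> S \<Longrightarrow> seg p z \<subseteq> S"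
  shows "d p x + d p y - gp p x y \<le> len S"
proof -
  have SX: "S \<subseteq> X" using closedin_subset[OF S] by simp
  then have X: "p \<in> X" "x \<in> X" "y \<in> X" using p xy by auto
  have k: "0 \<le> gp p x y" "gp p x y \<le> d p y"
    using gp_nonneg[OF X] gp_le[of p y x] X by (auto simp: gp_commute)
  obtain m where m: "m \<in> seg p y" "d p m = gp p x y"
    using seg_point[OF X(1,3) k] by blast
  have mX: "m \<in> X" using m seg_subset by blast
  have m_y: "d m y = d p y - gp p x y" using m by (simp add: seg_def)
  have beyond: "w \<in> seg p y \<and> d p w = gp p x y + d m w" if w: "w \<in> seg m y" for w
  proof -
    have wX: "w \<in> X" using w seg_subset by blast
    have "d m w + d w y = d m y" using w by (simp add: seg_def)
    then have "d p w = d p m + d m w" "d p w + d w y = d p y"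
      using triangle[of p m w] triangle[of p w y] X mX wX m m_y by linarith+
    then show ?thesis using wX m by (simp add: seg_def)
  qed
  have "m \<in> seg p x"
    using gp_seg[OF X(1,3,2) m(1)] X mX m(2) by (simp add: in_seg_iff_gp gp_commute)
  moreover have "m \<in> seg m y" using end_in_seg mX X by blast
  moreover have "w = m" if w: "w \<in> seg p x" "w \<in> seg m y" for w
  proof -
    have wX: "w \<in> X" using w seg_subset by blast
    have "gp p w y = min (d p w) (gp p x y)" using gp_seg[OF X w(1)] .
    moreover have "gp p w y = d p w" using gp_in_seg[of w p y] beyond[OF w(2)] by (simp add: gp_commute)
    ultimately have "d p w \<le> gp p x y" by simp
    then have "d m w = 0" using beyond[OF w(2)] nonneg[of m w] by linarith
    then show ?thesis using wX mX by simp
  qed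
  ultimately have inter: "seg p x \<inter> seg m y = {m}" by blast
  have "d p x + d m y \<le> len (seg p x) + len (seg m y)"
    using dist_le_len_seg X mX by (intro add_mono) auto
  also have "\<dots> = len (seg p x \<union> seg m y)"
    by (rule len_Un_point[symmetric, OF _ _ inter]) (simp_all add: seg_borel X mX)
  also have "\<dots> \<le> len S"
  proof (rule len_mono)
    show "seg p x \<union> seg m y \<subseteq> S" using star[OF xy(1)] star[OF xy(2)] beyond by blast
    show "seg p x \<union> seg m y \<in> borel_sets" using X mX by (intro sets.Un seg_borel)
    show "S \<in> borel_sets" by (rule closedin_in_borel_of[OF S])
  qed
  finally show ?thesis by (simp add: m_y)
qed

end


section \<open>An optimal decomposition at a centroid\<close>

context metric_tree
begin

lemma total_length_nonneg: "0 \<le> total_length T"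
  unfolding total_length_def using elen_pos by (intro sum_nonneg) (simp add: less_imp_le)

lemma closedin_gp_ge:
  assumes X: "p \<in> X" "x \<in> X"
  shows "closedin mtopology {y \<in> X. c \<le> gp p x y}"
proof -
  have "\<bar>gp p x y - gp p x z\<bar> \<le> d y z" if "y \<in> X" "z \<in> X" for y z
    using dist_lipschitz[OF X(1) that] dist_lipschitz[OF X(2) that] unfolding gp_def by argo
  then have "continuous_map mtopology euclideanreal (gp p x)"
    by (rule continuous_map_lipschitz)
  then have "closedin mtopology {y \<in> topspace mtopology. gp p x y \<in> {c..}}"
    by (rule closedin_continuous_map_preimage) simp
  then show ?thesis by simp
qed

lemma gp_ge_borel: "p \<in> X \<Longrightarrow> x \<in> X \<Longrightarrow> {y \<in> X. c \<le> gp p x y} \<in> borel_sets"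
  by (intro closedin_in_borel_of closedin_gp_ge)

lemma branch_borel: "p \<in> X \<Longrightarrow> x \<in> X \<Longrightarrow> branch p x \<in> borel_sets"
  by (intro openin_in_borel_of openin_branch)

lemma branch_union_borel: "branch_union p S \<Longrightarrow> S \<in> borel_sets"
  by (intro closedin_in_borel_of closedin_branch_union)

text \<open>The points whose path from \<open>a\<close> passes through \<open>x\<close>: the descendants of \<open>x\<close> in the tree rooted at \<open>a\<close>.\<close>

definition beyond :: "'v point \<Rightarrow> 'v point \<Rightarrow> 'v point set" where
  "beyond a x = {y \<in> X. d a x \<le> gp a x y}"

text \<open>
  The descendants of points close to \<open>l\<close> share with \<open>l\<close> the path from the root up to nearly the depth
  of \<open>l\<close>. The sets of all points with this property shrink to the descendants of \<open>l\<close>.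
\<close>

lemma closedin_heavy:
  assumes a: "a \<in> X"
  shows "closedin mtopology {x \<in> X. c \<le> len (beyond a x)}"
  unfolding metric_closedin_iff_sequentially_closed
proof (intro conjI allI impI)
  fix \<sigma> l assume "range \<sigma> \<subseteq> {x \<in> X. c \<le> len (beyond a x)} \<and> limitin mtopology \<sigma> l sequentially"
  then have \<sigma>: "range \<sigma> \<subseteq> {x \<in> X. c \<le> len (beyond a x)}"
    and lim: "limitin mtopology \<sigma> l sequentially" by simp_all
  have l: "l \<in> X" using limitin_mspace[OF lim] .
  have \<sigma>X: "\<sigma> n \<in> X" and \<sigma>c: "c \<le> len (beyond a (\<sigma> n))" for n using \<sigma> by auto
  define N where "N k = {y \<in> X. k \<le> gp a l y}" for k
  have N: "N k \<in> borel_sets" for k unfolding N_def by (rule gp_ge_borel[OF a l])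
  have "c \<le> len (N k)" if k: "k < d a l" for k
  proof -
    have "\<forall>\<^sub>F n in sequentially. d (\<sigma> n) l < d a l - k"
      using lim k by (auto simp: limitin_metric eventually_conj_iff)
    then obtain n where n: "d (\<sigma> n) l < d a l - k" by (meson eventually_happens trivial_limit_sequentially)
    have "k \<le> gp a l (\<sigma> n)"
      using n dist_lipschitz[OF a \<sigma>X l, of n] by (simp add: gp_def commute)
    have "beyond a (\<sigma> n) \<subseteq> N k"
    proof
      fix y assume "y \<in> beyond a (\<sigma> n)"
      then have "y \<in> X" "d a (\<sigma> n) \<le> gp a (\<sigma> n) y" by (auto simp: beyond_def)
      moreover have "gp a l (\<sigma> n) \<le> d a (\<sigma> n)"
        using gp_le[OF a \<sigma>X l] by (simp add: gp_commute)
      moreover have "min (gp a l (\<sigma> n)) (gp a (\<sigma> n) y) \<le> gp a l y"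
        using hyperbolic[OF a l \<sigma>X \<open>y \<in> X\<close>] .
      ultimately show "y \<in> N k" using \<open>k \<le> gp a l (\<sigma> n)\<close> by (simp add: N_def)
    qed
    then have "len (beyond a (\<sigma> n)) \<le> len (N k)"
      using N gp_ge_borel[OF a \<sigma>X] by (intro len_mono) (auto simp: beyond_def)
    then show ?thesis using \<sigma>c[of n] by simp
  qed
  then have "c \<le> len (N (d a l - 1 / real (Suc n)))" for n by simp
  moreover have "(\<lambda>n. len (N (d a l - 1 / real (Suc n)))) \<longlonglongrightarrow> len (\<Inter>n. N (d a l - 1 / real (Suc n)))"
  proof (rule len_LIMSEQ_decseq[OF N])
    have "N j \<subseteq> N i" if "i \<le> j" for i j using that by (auto simp: N_def)
    then show "decseq (\<lambda>n. N (d a l - 1 / real (Suc n)))"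
      unfolding decseq_def by (simp add: frac_le)
  qed
  moreover have "(\<Inter>n. N (d a l - 1 / real (Suc n))) = beyond a l"
  proof
    show "(\<Inter>n. N (d a l - 1 / real (Suc n))) \<subseteq> beyond a l"
    proof
      fix y assume y: "y \<in> (\<Inter>n. N (d a l - 1 / real (Suc n)))"
      have "(\<lambda>n. d a l - 1 / real (Suc n)) \<longlonglongrightarrow> d a l - 0"
        using LIMSEQ_inverse_real_of_nat by (intro tendsto_diff) (auto simp: inverse_eq_divide)
      then have "d a l - 0 \<le> gp a l y"
        by (rule LIMSEQ_le_const2) (use y in \<open>auto simp: N_def\<close>)
      then show "y \<in> beyond a l" using y by (auto simp: beyond_def N_def)
    qed
    have "d a l - 1 / real (Suc n) \<le> k" if "d a l \<le> k" for n k
      using that by (smt (verit) divide_pos_pos of_nat_0_less_iff zero_less_Suc)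
    then show "beyond a l \<subseteq> (\<Inter>n. N (d a l - 1 / real (Suc n)))"
      by (auto simp: beyond_def N_def)
  qed
  ultimately show "l \<in> {x \<in> X. c \<le> len (beyond a x)}"
    using LIMSEQ_le_const[of _ _ c] l by auto
qed auto

text \<open>
  Root the tree at \<open>a\<close> and take the deepest \<open>p\<close> whose descendants carry at least half of the total
  length. The branch towards the root then has at most half; and a heavier downward branch would
  remain heavy a little below \<open>p\<close>, against the choice of \<open>p\<close>.
\<close>

lemma centroid_exists:
  obtains p where "p \<in> X" "\<And>x. x \<in> X \<Longrightarrow> len (branch p x) \<le> total_length T / 2"
proof -
  obtain a where a: "a \<in> X" using points_nonempty by blast
  define H where "H = {x \<in> X. total_length T / 2 \<le> len (beyond a x)}"
  have "beyond a a = X" using a gp_nonneg[OF a a] by (auto simp: beyond_def)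
  then have "a \<in> H" using a total_length_nonneg by (simp add: H_def len_X)
  moreover have "closedin mtopology H" unfolding H_def by (rule closedin_heavy[OF a])
  moreover have "continuous_map mtopology euclideanreal (\<lambda>x. - d a x)"
    using continuous_map_dist[OF a] by (rule continuous_map_minus)
  ultimately obtain p where p: "p \<in> H" and max: "\<And>x. x \<in> H \<Longrightarrow> d a x \<le> d a p"
    using attains_min[of "\<lambda>x. - d a x" H] by auto
  have pX: "p \<in> X" and heavy: "total_length T / 2 \<le> len (beyond a p)" using p by (auto simp: H_def)
  have "len (branch p x) \<le> total_length T / 2" if x: "x \<in> X" for x
  proof (cases "0 < gp p x a")
    case True
    have "branch p x \<inter> beyond a p = {}"
    proof (rule ccontr)
      assume "branch p x \<inter> beyond a p \<noteq> {}"
      then obtain y where y: "y \<in> X" "0 < gp p x y" "d a p \<le> gp a p y"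
        by (auto simp: branch_def beyond_def)
      then have "0 < gp p y a"
        using branch_trans[OF pX y(1) x a] True by (simp add: gp_commute)
      then show False using y(3) by (simp add: gp_def commute)
    qed
    then have "branch p x \<subseteq> X - beyond a p" using branch_subset by blast
    then have "len (branch p x) \<le> len (X - beyond a p)"
      using X_in_borel_sets branch_borel[OF pX x] gp_ge_borel[OF a pX]
      by (intro len_mono) (auto simp: beyond_def)
    then show ?thesis using len_Diff[of "beyond a p"] gp_ge_borel[OF a pX] heavy by (simp add: beyond_def)
  next
    case False
    then have xa: "gp p x a = 0" using gp_nonneg[OF pX x a] by simp
    show ?thesis
    proof (rule ccontr)
      assume "\<not> ?thesis"
      then have big: "total_length T / 2 < len (branch p x)" by simp
      define N where "N n = {y \<in> X. 1 / real (Suc n) \<le> gp p x y}" for n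
      have N: "N n \<in> borel_sets" for n unfolding N_def by (rule gp_ge_borel[OF pX x])
      have "1 / real (Suc j) \<le> 1 / real (Suc i)" if "i \<le> j" for i j
        using that by (simp add: frac_le)
      then have "incseq N"
        unfolding incseq_def N_def using order_trans by blast
      moreover have "(\<Union>n. N n) = branch p x"
      proof
        show "(\<Union>n. N n) \<subseteq> branch p x"
          by (auto simp: N_def branch_def intro: less_le_trans[rotated])
        show "branch p x \<subseteq> (\<Union>n. N n)"
        proof
          fix y assume y: "y \<in> branch p x"
          then obtain n where "inverse (real (Suc n)) < gp p x y"
            using reals_Archimedean by (auto simp: branch_def)
          then show "y \<in> (\<Union>n. N n)" using y by (auto simp: N_def branch_def inverse_eq_divide intro!: exI[of _ n])
        qed
      qed
      ultimately have "(\<lambda>n. len (N n)) \<longlonglongrightarrow> len (branch p x)"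
        using len_LIMSEQ_incseq[of N] N by simp
      then have "\<forall>\<^sub>F n in sequentially. total_length T / 2 < len (N n)"
        using big by (rule order_tendstoD)
      then obtain n where n: "total_length T / 2 < len (N n)"
        by (meson eventually_happens trivial_limit_sequentially)
      define \<delta> where "\<delta> = 1 / real (Suc n)"
      \<comment> \<open>The points of the branch beyond depth \<open>\<delta>\<close> are descendants of one point \<open>p'\<close> below \<open>p\<close>.\<close>
      have \<delta>: "0 < \<delta>" by (simp add: \<delta>_def)
      have "N n \<noteq> {}"
      proof
        assume "N n = {}"
        then show False using n total_length_nonneg by (simp add: subtree_length_def)
      qed
      then obtain y0 where "y0 \<in> X" "\<delta> \<le> gp p x y0" by (auto simp: N_def \<delta>_def)
      then have "\<delta> \<le> d p x" using gp_le[OF pX x] by force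
      then obtain p' where p': "p' \<in> seg p x" "d p p' = \<delta>"
        using seg_point[OF pX x] \<delta> by (metis less_imp_le)
      have p'X: "p' \<in> X" using p' seg_subset by blast
      have "gp p p' a = 0" using gp_seg[OF pX x a p'(1)] xa \<delta> p' by simp
      then have ap': "d a p' = d a p + \<delta>" using p' by (simp add: gp_def commute)
      have "N n \<subseteq> beyond a p'"
      proof
        fix y assume "y \<in> N n"
        then have y: "y \<in> X" "\<delta> \<le> gp p x y" by (auto simp: N_def \<delta>_def)
        have "gp p p' y = \<delta>" using gp_seg[OF pX x y(1) p'(1)] p' y by simp
        then have "d p' y = d p y - \<delta>" using p' by (simp add: gp_def)
        moreover have "gp p y a \<le> 0"
          using hyperbolic[OF pX x y(1) a] xa y \<delta> by simp
        ultimately show "y \<in> beyond a p'" using ap' y by (simp add: beyond_def gp_def commute)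
      qed
      then have "len (N n) \<le> len (beyond a p')"
        using N gp_ge_borel[OF a p'X] by (intro len_mono) (auto simp: beyond_def)
      then have "p' \<in> H" using n p'X by (simp add: H_def)
      then show False using max[of p'] ap' \<delta> by simp
    qed
  qed
  then show thesis using that pX by blast
qed

text \<open>
  Each edge contributes to the complement of \<open>p\<close> at most two half-edges, cut at the projection of
  \<open>p\<close>, and each of them lies in one branch. So there are only finitely many branches.
\<close>

lemma finite_branch_unions:
  assumes p: "p \<in> X"
  shows "finite {S. branch_union p S}"
proof -
  define P where "P = (\<lambda>v. {Vertex v}) ` verts T
    \<union> (\<lambda>e. {edge_point T e (coordinate e p)}) ` edges T
    \<union> (\<lambda>e. edge_point T e ` {t \<in> {0..elen T e}. t < coordinate e p}) ` edges T
    \<union> (\<lambda>e. edge_point T e ` {t \<in> {0..elen T e}. coordinate e p < t}) ` edges T"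
  have "finite P"
    using finite_edges[OF tree] tree by (simp add: P_def finite_metric_tree_def)
  have same: "0 < gp p (edge_point T e t) (edge_point T e t')"
    if "e \<in> edges T" "t \<in> {0..elen T e}" "t' \<in> {0..elen T e}"
      "t < coordinate e p \<and> t' < coordinate e p \<or> coordinate e p < t \<and> coordinate e p < t'" for e t t'
  proof -
    have "\<bar>coordinate e p - t\<bar> \<le> d p (edge_point T e t)" "\<bar>coordinate e p - t'\<bar> \<le> d p (edge_point T e t')"
      using coordinate_lipschitz[OF that(1) p, of "edge_point T e t"]
        coordinate_lipschitz[OF that(1) p, of "edge_point T e t'"] that
      by (simp_all add: coordinate_same edge_point_in_points)
    then show ?thesis using edge_dist[OF that(1-3)] that(4) unfolding gp_def by auto
  qed
  have whole: "A \<subseteq> S" if A: "A \<in> P" "A \<inter> S \<noteq> {}" and S: "branch_union p S" for A S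
  proof -
    have "y \<in> S" if "x \<in> A" "x \<in> S" "y \<in> A" for x y
    proof (cases "x = y")
      case False
      have "y \<in> X \<and> 0 < gp p x y"
        using A(1) that False same edge_point_in_points[where T = T] unfolding P_def by auto
      then show ?thesis using branch_unionD[OF S] that by blast
    qed (use that in simp)
    then show ?thesis using A(2) by blast
  qed
  have cover: "\<exists>A\<in>P. x \<in> A" if "x \<in> X" for x
    using that
  proof (cases rule: points_cases)
    case (vertex v)
    then show ?thesis by (auto simp: P_def)
  next
    case (inner e t)
    consider "t < coordinate e p" | "t = coordinate e p" | "coordinate e p < t" by linarith
    then show ?thesis
    proof cases
      case 1
      then show ?thesis using inner(1-3) unfolding inner(5) P_def
        by (intro bexI[of _ "edge_point T e ` {t \<in> {0..elen T e}. t < coordinate e p}"]) auto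
    next
      case 2
      then show ?thesis using inner(1-3) unfolding inner(5) P_def
        by (intro bexI[of _ "{edge_point T e (coordinate e p)}"]) auto
    next
      case 3
      then show ?thesis using inner(1-3) unfolding inner(5) P_def
        by (intro bexI[of _ "edge_point T e ` {t \<in> {0..elen T e}. coordinate e p < t}"]) auto
    qed
  qed
  have "S = \<Union>{A \<in> P. A \<subseteq> S}" if "branch_union p S" for S
  proof
    show "S \<subseteq> \<Union>{A \<in> P. A \<subseteq> S}"
    proof
      fix x assume x: "x \<in> S"
      then have "x \<in> X" using that by (auto simp: branch_union_def)
      then obtain A where "A \<in> P" "x \<in> A" using cover by blast
      then show "x \<in> \<Union>{A \<in> P. A \<subseteq> S}" using whole[OF _ _ that, of A] x by blast
    qed
  qed blast
  then have "{S. branch_union p S} \<subseteq> Union ` Pow P" by blast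
  then show ?thesis using \<open>finite P\<close> by (meson finite_Pow_iff finite_imageI finite_subset)
qed

lemma len_insert_branch:
  assumes "p \<in> X" "x \<in> X"
  shows "len (insert p (branch p x)) = len (branch p x)"
proof -
  have "p \<notin> branch p x" using assms gp_le[of p p x] by (simp add: branch_def gp_commute)
  then show ?thesis
    using len_Un_disjoint[of "{p}" "branch p x"] borel_singleton branch_borel assms
    by (simp add: len_singleton)
qed

lemma len_opposite:
  assumes S: "branch_union p S"
  shows "len (insert p (X - S)) = total_length T - len S"
proof -
  have "S \<union> insert p (X - S) = X" "S \<inter> insert p (X - S) = {p}"
    using S by (auto simp: branch_union_def)
  then show ?thesis
    using len_Un_point[of S "insert p (X - S)" p] branch_union_borel S branch_union_opposite[OF S]
    by (simp add: len_X)
qed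

lemma two_piece_branch_union:
  assumes S: "branch_union p S"
  shows "two_piece_decomposition T S (insert p (X - S))"
  unfolding two_piece_decomposition_def
  using S len_opposite[OF S] metric_subtree_branch_union[OF S]
    metric_subtree_branch_union[OF branch_union_opposite[OF S]]
  by (auto simp: branch_union_def)

text \<open>
  A decomposition at another point \<open>q\<close> is not better than splitting off the branch of the centroid
  that contains \<open>q\<close>: the piece containing the centroid contains all the other branches.
\<close>

lemma centroid_split_optimal:
  assumes p: "p \<in> X" and centroid: "\<And>x. x \<in> X \<Longrightarrow> len (branch p x) \<le> total_length T / 2"
    and dec: "two_piece_decomposition T T1 T2"
  shows "\<exists>S. branch_union p S \<and> max (len S) (len (insert p (X - S))) \<le> max (len T1) (len T2)"
proof -
  have main: ?thesis
    if pT: "p \<in> A" and sub: "metric_subtree T A" "metric_subtree T B" and Xeq: "X = A \<union> B"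
      and inter: "A \<inter> B = {q}" and m: "max (len A) (len B) = max (len T1) (len T2)" for A B q
  proof -
    have conn: "connectedin mtopology A" "connectedin mtopology B"
      and bor: "A \<in> borel_sets" "B \<in> borel_sets"
      using sub by (auto simp: metric_subtree_def tree_topology_eq intro: closedin_in_borel_of)
    have q: "q \<in> X" "q \<in> B" using Xeq inter by auto
    note across = gp_across_pieces[OF conn inter]
    show ?thesis
    proof (cases "p = q")
      case True
      have "branch_union p A"
        using pT Xeq across True by (fastforce simp: branch_union_def branch_def)
      moreover have "insert p (X - A) = B" using Xeq inter True by blast
      ultimately show ?thesis using m by (intro exI[of _ A]) simp
    next
      case False
      let ?S = "insert p (branch p q)"
      have S: "branch_union p ?S" using branch_union_insert_branch p q by blast
      have "insert p (X - ?S) \<subseteq> A"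
      proof
        fix y assume y: "y \<in> insert p (X - ?S)"
        show "y \<in> A"
        proof (rule ccontr)
          assume "y \<notin> A"
          then have "y \<in> X" "y \<in> B" "y \<notin> branch p q" using y pT Xeq by auto
          moreover have "gp q p y = 0" using across pT \<open>y \<in> B\<close> by blast
          then have "gp p q y = d p q" by (simp add: gp_def commute)
          ultimately show False using False p q by (simp add: branch_def mdist_pos_less)
        qed
      qed
      then have "len (insert p (X - ?S)) \<le> len A"
        using bor branch_union_borel[OF branch_union_opposite[OF S]] by (intro len_mono)
      moreover have "len ?S \<le> total_length T / 2"
        using centroid[OF q(1)] len_insert_branch[OF p q(1)] by simp
      moreover have "total_length T = len A + len B"
        using len_Un_point[OF bor inter] Xeq len_X by simp
      ultimately have "max (len ?S) (len (insert p (X - ?S))) \<le> max (len A) (len B)" by linarith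
      then show ?thesis using S m by (intro exI[of _ ?S]) simp
    qed
  qed
  obtain q where dec': "metric_subtree T T1" "metric_subtree T T2" "X = T1 \<union> T2" "T1 \<inter> T2 = {q}"
    using dec by (auto simp: two_piece_decomposition_def)
  show ?thesis
  proof (cases "p \<in> T1")
    case True
    then show ?thesis using main[of T1 T2 q] dec' by blast
  next
    case False
    then have "p \<in> T2" using p dec' by blast
    then show ?thesis using main[of T2 T1 q] dec' by (simp add: Un_commute Int_commute max.commute)
  qed
qed

text \<open>
  Splitting off one branch is a decomposition too. Its smaller piece is that branch, because the
  branches at a centroid have at most half of the length, so the rest has length at least
  \<open>\<lambda>(T)\<close>: this is the bound on the branches.
\<close>

lemma optimal_split_exists:
  obtains p S where "branch_union p S"
    "len S \<le> tree_lambda T" "len (insert p (X - S)) \<le> tree_lambda T"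
    "total_length T \<le> 2 * tree_lambda T"
    "\<And>x. x \<in> X \<Longrightarrow> len (branch p x) \<le> total_length T - tree_lambda T"
proof -
  obtain p where p: "p \<in> X" and centroid: "\<And>x. x \<in> X \<Longrightarrow> len (branch p x) \<le> total_length T / 2"
    using centroid_exists by blast
  define cost where "cost S = max (len S) (len (insert p (X - S)))" for S
  have "branch_union p X" using p branch_subset by (auto simp: branch_union_def)
  then have "{S. branch_union p S} \<noteq> {}" by blast
  then obtain S where S: "branch_union p S" and min: "\<And>S'. branch_union p S' \<Longrightarrow> cost S \<le> cost S'"
    using ex_min_if_finite[OF finite_imageI[OF finite_branch_unions[OF p], of cost]]
    by (force simp: not_less)
  have lam: "tree_lambda T = cost S"
    unfolding tree_lambda_def
  proof (rule cInf_eq_minimum)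
    show "cost S \<in> {max (len T1) (len T2) |T1 T2. two_piece_decomposition T T1 T2}"
      using two_piece_branch_union[OF S] by (auto simp: cost_def)
    fix c assume "c \<in> {max (len T1) (len T2) |T1 T2. two_piece_decomposition T T1 T2}"
    then obtain T1 T2 where "c = max (len T1) (len T2)" "two_piece_decomposition T T1 T2" by blast
    then obtain S' where "branch_union p S'" "cost S' \<le> c"
      using centroid_split_optimal[OF p centroid] by (auto simp: cost_def)
    then show "cost S \<le> c" using min by force
  qed
  show thesis
  proof (rule that[OF S])
    show "len S \<le> tree_lambda T" "len (insert p (X - S)) \<le> tree_lambda T"
      by (simp_all add: lam cost_def)
    show "total_length T \<le> 2 * tree_lambda T" 
      using len_opposite[OF S] unfolding lam cost_def by linarith
    fix x assume x: "x \<in> X"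
    have b: "branch_union p (insert p (branch p x))" by (rule branch_union_insert_branch[OF p x])
    show "len (branch p x) \<le> total_length T - tree_lambda T"
      using min[OF b] centroid[OF x] len_opposite[OF b] len_insert_branch[OF p x]
      unfolding lam cost_def by linarith
  qed
qed

end


section \<open>Two balls that cover the tree\<close>

context metric_tree
begin

lemma dist_from_seg:
  assumes "p \<in> X" "h \<in> X" "z \<in> X" "w \<in> seg p h"
  shows "d w z = d p w + d p z - 2 * min (d p w) (gp p h z)"
  using dist_eq_gp[of w z p] gp_seg[OF assms] by simp

lemma farthest_exists:
  assumes S: "closedin mtopology S" and p: "p \<in> S"
  obtains f where "f \<in> S" "\<And>x. x \<in> S \<Longrightarrow> d p x \<le> d p f"
proof -
  have "p \<in> X" using p closedin_subset[OF S] by auto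
  then have "continuous_map mtopology euclideanreal (\<lambda>x. - d p x)"
    using continuous_map_dist by (intro continuous_map_minus)
  then show thesis using attains_min[OF _ S] p that by fastforce
qed

text \<open>
  The ball of radius \<open>t\<close> around \<open>c t\<close> has to contain the shallower piece \<open>B\<close>, and its centre lies
  on the path from \<open>p\<close> to the deepest point \<open>g\<close> of \<open>B\<close>, as close to \<open>p\<close> as \<open>g\<close> permits. Since \<open>B\<close> has
  length at most \<open>l \<le> 2 t\<close>, the tripod spanned by \<open>p\<close>, \<open>g\<close> and a point of \<open>B\<close> is too short for that
  point to be missed. The ball of radius \<open>u\<close> around \<open>c' u\<close> has its centre on the path from \<open>p\<close> to the
  deepest point \<open>f\<close> of the other piece \<open>A\<close>, again as close to \<open>p\<close> as \<open>f\<close> permits. A point \<open>x\<close> of \<open>A\<close> that both balls miss is deep. The tripod spanned by \<open>p\<close>,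
  \<open>f\<close> and \<open>x\<close> is then longer than \<open>l\<close> if \<open>f\<close> and \<open>x\<close> lie in different branches, and longer than \<open>b\<close> if
  they lie in the same one.
\<close>

lemma two_balls_cover_aux:
  assumes A: "branch_union p A" and B: "branch_union p B" and AB: "A \<union> B = X" "A \<inter> B = {p}"
    and lenA: "len A \<le> l" and lenB: "len B \<le> l"
    and b: "0 \<le> b" "\<And>x. x \<in> X \<Longrightarrow> len (branch p x) \<le> b"
    and f: "f \<in> A" "\<And>x. x \<in> A \<Longrightarrow> d p x \<le> d p f"
    and g: "g \<in> B" "\<And>x. x \<in> B \<Longrightarrow> d p x \<le> d p g"
    and gf: "d p g \<le> d p f"
  shows "\<exists>c c'. continuous_map euclideanreal mtopology c \<and> continuous_map euclideanreal mtopology c' \<and>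
    (\<forall>t\<ge>l / 2. \<forall>x\<in>X. (b \<le> t \<longrightarrow> d (c t) x \<le> t) \<and>
      (\<forall>u\<ge>0. b \<le> t + u \<longrightarrow> d (c t) x \<le> t \<or> d (c' u) x \<le> u))"
proof -
  have X: "p \<in> X" "f \<in> X" "g \<in> X" using AB f g by auto
  have tripod: "d p x + d p y - gp p x y \<le> l" if "x \<in> A \<and> y \<in> A \<or> x \<in> B \<and> y \<in> B" for x y
  proof -
    have "d p x + d p y - gp p x y \<le> len S" if "branch_union p S" "x \<in> S" "y \<in> S" for S
      using that seg_subset_branch_union[OF that(1)]
      by (intro tripod_le_len closedin_branch_union[OF that(1)]) (auto simp: branch_union_def)
    then show ?thesis using that A B lenA lenB by (meson order_trans)
  qed
  have tripod_branch: "d p x + d p y - gp p x y \<le> b" if xy: "x \<in> X" "y \<in> X" "0 < gp p x y" for x y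
  proof -
    let ?S = "insert p (branch p x)"
    have S: "branch_union p ?S" by (rule branch_union_insert_branch[OF X(1) xy(1)])
    have "0 < gp p x x" using gp_le[OF X(1) xy(1,2)] xy(1,3) by (simp add: gp_self)
    then have "d p x + d p y - gp p x y \<le> len ?S"
      using xy seg_subset_branch_union[OF S]
      by (intro tripod_le_len closedin_branch_union[OF S]) (auto simp: branch_def)
    then show ?thesis using b(2)[OF xy(1)] len_insert_branch[OF X(1) xy(1)] by simp
  qed
  have cross: "gp p x y = 0" if xy: "x \<in> B" "y \<in> A" for x y
  proof (rule ccontr)
    assume ne: "gp p x y \<noteq> 0"
    have xyX: "x \<in> X" "y \<in> X" using xy AB by auto
    then have pos: "0 < gp p x y" using ne gp_nonneg[OF X(1)] by fastforce
    then have "y \<in> B" using branch_unionD[OF B xy(1) xyX(2)] by simp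
    then have "y = p" using xy AB by blast
    then show False using ne X xyX by (simp add: gp_def commute)
  qed
  have fb: "d p f \<le> b"
    using tripod_branch[OF X(2,2)] b(1) X nonneg[of p f] by (cases "d p f = 0") (auto simp: gp_self)
  obtain \<alpha> where \<alpha>: "\<And>a. \<alpha> a \<in> seg p f" "\<And>a. a \<in> {0..d p f} \<Longrightarrow> d p (\<alpha> a) = a"
      "\<And>a a'. d (\<alpha> a) (\<alpha> a') \<le> \<bar>a - a'\<bar>"
    using geodesic_exists[OF X(1,2)] by blast
  obtain \<beta> where \<beta>: "\<And>a. \<beta> a \<in> seg p g" "\<And>a. a \<in> {0..d p g} \<Longrightarrow> d p (\<beta> a) = a"
      "\<And>a a'. d (\<beta> a) (\<beta> a') \<le> \<bar>a - a'\<bar>"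
    using geodesic_exists[OF X(1,3)] by blast
  define c where "c t = \<beta> (max 0 (d p g - t))" for t
  define c' where "c' u = \<alpha> (max 0 (d p f - u))" for u
  have cX: "c t \<in> X" "c' t \<in> X" for t
    using subsetD[OF seg_subset \<alpha>(1)] subsetD[OF seg_subset \<beta>(1)] by (simp_all add: c_def c'_def)
  have "d (c t) (c t') \<le> \<bar>t - t'\<bar>" "d (c' t) (c' t') \<le> \<bar>t - t'\<bar>" for t t'
    unfolding c_def c'_def by (rule order_trans[OF \<beta>(3)] order_trans[OF \<alpha>(3)], linarith)+
  then have cont: "continuous_map euclideanreal mtopology c" "continuous_map euclideanreal mtopology c'"
    using cX by (auto intro: continuous_map_lipschitz_curve)
  have l0: "0 \<le> l" using tripod[of p p] AB X by (auto simp: gp_def)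
  have cover: "(b \<le> t \<longrightarrow> d (c t) x \<le> t) \<and>
      (\<forall>u\<ge>0. b \<le> t + u \<longrightarrow> d (c t) x \<le> t \<or> d (c' u) x \<le> u)" if t: "l / 2 \<le> t" and x: "x \<in> X" for t x
  proof -
    define a where "a = max 0 (d p g - t)"
    have t0: "0 \<le> t" using t l0 by simp
    have dc: "d (c t) x = a + d p x - 2 * min a (gp p g x)"
      using dist_from_seg[OF X(1,3) x \<beta>(1), of a] \<beta>(2)[of a] t0 nonneg[of p g]
      by (auto simp: c_def a_def)
    have a: "a = 0 \<and> d p g \<le> t \<or> a = d p g - t \<and> 0 \<le> a" by (auto simp: a_def)
    show ?thesis
    proof (cases "x \<in> B")
      case True
      have "d p g + d p x - gp p g x \<le> l" using tripod True g by blast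
      moreover have "0 \<le> gp p g x" using gp_nonneg X x by blast
      ultimately have "d (c t) x \<le> t"
        using g(2)[OF True] t a unfolding dc min_def by auto
      then show ?thesis by blast
    next
      case False
      then have xA: "x \<in> A" using x AB by blast
      have k: "0 \<le> gp p f x" using gp_nonneg X x by blast
      have xf: "d p x \<le> d p f" by (rule f(2)[OF xA])
      have xl: "d p f + d p x - gp p f x \<le> l" using tripod xA f by blast
      have dc': "d (c t) x = a + d p x" using dc cross[OF g(1) xA] by (simp add: a_def)
      have "d (c t) x \<le> t \<or> d (c' u) x \<le> u" if u: "0 \<le> u" "b \<le> t + u" for u
      proof -
        define a' where "a' = max 0 (d p f - u)"
        have dc'': "d (c' u) x = a' + d p x - 2 * min a' (gp p f x)"
          using dist_from_seg[OF X(1,2) x \<alpha>(1), of a'] \<alpha>(2)[of a'] u nonneg[of p f]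
          by (auto simp: c'_def a'_def)
        have a': "a' = 0 \<and> d p f \<le> u \<or> a' = d p f - u \<and> 0 \<le> a'" by (auto simp: a'_def)
        consider "a' \<le> gp p f x" | "gp p f x = 0" | "gp p f x < a'" "0 < gp p f x"
          using k by linarith
        then show ?thesis
        proof cases
          case 1
          then show ?thesis using xf a' unfolding dc'' by auto
        next
          case 2
          then show ?thesis using xl xf gf t a unfolding dc' by auto
        next
          case 3
          then have "d p f + d p x - gp p f x \<le> b" using tripod_branch X x by blast
          then show ?thesis using 3 xf gf u a a' unfolding dc' dc'' by auto
        qed
      qed
      moreover have "d (c t) x \<le> t" if "b \<le> t"
        using that fb xf gf a unfolding dc' by auto
      ultimately show ?thesis by blast
    qed
  qed
  show ?thesis using cont cover by blast
qed

lemma two_balls_cover: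
  obtains c c' where "continuous_map euclideanreal mtopology c" "continuous_map euclideanreal mtopology c'"
    "\<And>t x. tree_lambda T / 2 \<le> t \<Longrightarrow> total_length T - tree_lambda T \<le> t \<Longrightarrow> x \<in> X \<Longrightarrow> d x (c t) \<le> t"
    "\<And>t u x. tree_lambda T / 2 \<le> t \<Longrightarrow> 0 \<le> u \<Longrightarrow> total_length T - tree_lambda T \<le> t + u \<Longrightarrow> x \<in> X \<Longrightarrow>
      d x (c t) \<le> t \<or> d x (c' u) \<le> u"
proof -
  obtain p S where S: "branch_union p S"
    "len S \<le> tree_lambda T" "len (insert p (X - S)) \<le> tree_lambda T"
    and b: "\<And>x. x \<in> X \<Longrightarrow> len (branch p x) \<le> total_length T - tree_lambda T"
    using optimal_split_exists by blast
  let ?S' = "insert p (X - S)"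
  have S': "branch_union p ?S'" by (rule branch_union_opposite[OF S(1)])
  have p: "p \<in> S" "p \<in> X" "S \<subseteq> X" using S by (auto simp: branch_union_def)
  have parts: "S \<union> ?S' = X" "S \<inter> ?S' = {p}" "?S' \<union> S = X" "?S' \<inter> S = {p}" using p by auto
  have "0 \<le> len (branch p p)" by (simp add: subtree_length_def sum_nonneg)
  then have b0: "0 \<le> total_length T - tree_lambda T" using b[OF p(2)] by simp
  obtain f where f: "f \<in> S" "\<And>x. x \<in> S \<Longrightarrow> d p x \<le> d p f"
    using farthest_exists[OF closedin_branch_union[OF S(1)] p(1)] by blast
  obtain g where g: "g \<in> ?S'" "\<And>x. x \<in> ?S' \<Longrightarrow> d p x \<le> d p g"
    using farthest_exists[OF closedin_branch_union[OF S'], of p] by blast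
  have "\<exists>c c'. continuous_map euclideanreal mtopology c \<and> continuous_map euclideanreal mtopology c' \<and>
    (\<forall>t\<ge>tree_lambda T / 2. \<forall>x\<in>X. (total_length T - tree_lambda T \<le> t \<longrightarrow> d (c t) x \<le> t) \<and>
      (\<forall>u\<ge>0. total_length T - tree_lambda T \<le> t + u \<longrightarrow> d (c t) x \<le> t \<or> d (c' u) x \<le> u))"
  proof (cases "d p g \<le> d p f")
    case True
    show ?thesis
      by (rule two_balls_cover_aux[OF S(1) S' parts(1,2) S(2,3) b0 b f g True])
  next
    case False
    then have gf: "d p f \<le> d p g" by simp
    show ?thesis
      by (rule two_balls_cover_aux[OF S' S(1) parts(3,4) S(3,2) b0 b g f gf])
  qed
  then show thesis using that by (metis commute)
qed

end


section \<open>The certificate\<close>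

lemma emeasure_scale_law:
  assumes a: "0 < a" and L: "0 \<le> total_length T" and A: "A \<in> sets borel"
  shows "emeasure (scale_law T a) A =
    (\<integral>\<^sup>+v. ennreal (total_length T / a\<^sup>2 * indicator {0..a} v) * indicator A v \<partial>lborel)"
proof -
  have "(\<integral>\<^sup>+v. ennreal (total_length T / a\<^sup>2 * indicator {0..a} v) * indicator A v \<partial>lborel) =
      (\<integral>\<^sup>+v. ennreal (total_length T / a\<^sup>2) * indicator ({0..a} \<inter> A) v \<partial>lborel)"
    by (intro nn_integral_cong) (auto simp: indicator_def)
  also have "\<dots> = ennreal (total_length T / a\<^sup>2) * emeasure lborel ({0..a} \<inter> A)"
    using A by (intro nn_integral_cmult_indicator) auto
  also have "ennreal (total_length T / a\<^sup>2) = ennreal (total_length T / a) * inverse (ennreal a)"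
    using a L by (simp add: inverse_ennreal ennreal_mult[symmetric] power2_eq_square divide_inverse mult.assoc)
  finally show ?thesis
    using a A by (simp add: scale_law_def divide_ennreal_def mult_ac)
qed

context metric_tree
begin

lemma covering_radii_fmeasurable:
  assumes x: "x \<in> X" and c: "continuous_map euclideanreal mtopology c"
  shows "{t \<in> {a<..b}. d x (c t) \<le> t} \<in> fmeasurable lborel"
proof (rule fmeasurableI2)
  have "continuous_map euclideanreal euclideanreal (d x \<circ> c)"
    by (rule continuous_map_compose[OF c continuous_map_dist[OF x]])
  then have [measurable]: "(\<lambda>v. d x (c v)) \<in> borel_measurable borel"
    by (simp add: o_def borel_measurable_continuous_onI)
  show "{t \<in> {a<..b}. d x (c t) \<le> t} \<in> sets lborel" by measurable
  have "emeasure lborel {a<..b} < \<infinity>" by (cases "a \<le> b") simp_all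
  then show "{a<..b} \<in> fmeasurable lborel" by (simp add: fmeasurable_def)
qed auto

text \<open>
  The measure puts a ball of each radius \<open>v\<close> in \<open>(s, r]\<close> around \<open>c v\<close> with the full density, and a
  ball of each radius \<open>v\<close> in \<open>(u, s]\<close> around \<open>c' v\<close> with the fraction \<open>\<rho>\<close> of it. The radii that are
  left form a mixture of the uniform laws on \<open>[0, s]\<close> and on \<open>[0, u]\<close>.
\<close>

lemma two_curve_certificate:
  assumes s: "0 < s" "s < r" and u: "0 \<le> u" "u < s" and \<rho>: "0 \<le> \<rho>" "\<rho> \<le> 1"
    and c: "continuous_map euclideanreal mtopology c" and c': "continuous_map euclideanreal mtopology c'"
    and cover: "\<And>x. x \<in> X \<Longrightarrow> r - s \<le> measure lborel {t \<in> {s<..r}. d x (c t) \<le> t}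
      + \<rho> * measure lborel {t \<in> {u<..s}. d x (c' t) \<le> t}"
    and total: "1 \<le> total_length T / r\<^sup>2 * (r - s) + (1 - \<rho>) * s\<^sup>2 / r\<^sup>2 + \<rho> * u\<^sup>2 / r\<^sup>2"
  shows "\<exists>\<eta> q sc w. replacement_certificate T r \<eta> q sc w \<and> (\<forall>j<q. sc j \<le> s)"
proof -
  define K where "K = total_length T / r\<^sup>2"
  have K: "0 \<le> K" using total_length_nonneg by (simp add: K_def)
  define D where "D v = K * indicator {s<..r} v + \<rho> * K * indicator {u<..s} v" for v :: real
  have D0: "0 \<le> D v" for v using K \<rho> by (simp add: D_def)
  have D_meas: "D \<in> borel_measurable borel" unfolding D_def by measurable
  define N where "N = density lborel (\<lambda>v. ennreal (D v))"
  have N_em: "emeasure N A = (\<integral>\<^sup>+v. ennreal (D v) * indicator A v \<partial>lborel)" if "A \<in> sets borel" for A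
    unfolding N_def using that D_meas by (intro emeasure_density) auto
  \<comment> \<open>Radii outside \<open>[0, r]\<close> carry no mass; clamping only keeps the values in the space.\<close>
  define cl where "cl v = max 0 (min r v)" for v :: real
  define C where "C v = (if s < v then c v else c' v)" for v
  define F where "F v = (C v, cl v)" for v
  let ?B = "borel_of (scale_space T r)"
  have cl_cont: "continuous_map euclideanreal (top_of_set {0..r}) cl"
    unfolding cl_def using s by (intro continuous_map_into_subtopology) (auto intro!: continuous_intros)
  have "continuous_map euclideanreal (scale_space T r) (\<lambda>v. (c v, cl v))"
    "continuous_map euclideanreal (scale_space T r) (\<lambda>v. (c' v, cl v))"
    unfolding scale_space_def tree_topology_eq using c c' cl_cont
    by (auto intro: continuous_map_pairedI)
  then have "(\<lambda>v. (c v, cl v)) \<in> borel \<rightarrow>\<^sub>M ?B" "(\<lambda>v. (c' v, cl v)) \<in> borel \<rightarrow>\<^sub>M ?B"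
    by (auto intro: continuous_map_measurable_borel_of)
  then have "(\<lambda>v. if s < v then (c v, cl v) else (c' v, cl v)) \<in> borel \<rightarrow>\<^sub>M ?B"
    by (rule measurable_If) simp
  moreover have "(\<lambda>v. if s < v then (c v, cl v) else (c' v, cl v)) = F"
    by (auto simp: F_def C_def)
  ultimately have F_borel: "F \<in> borel \<rightarrow>\<^sub>M ?B" by simp
  then have F: "F \<in> N \<rightarrow>\<^sub>M ?B" by (simp add: N_def)
  define \<eta> where "\<eta> = distr N ?B F"
  have fin_N: "emeasure N UNIV < \<infinity>"
  proof -
    have "emeasure N UNIV = (\<integral>\<^sup>+v. ennreal (D v) \<partial>lborel)" using N_em[of UNIV] by simp
    also have "\<dots> \<le> (\<integral>\<^sup>+v. ennreal (2 * K) * indicator {u..r} v \<partial>lborel)"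
      using K \<rho> s u mult_right_mono[OF \<rho>(2) K]
      by (intro nn_integral_mono) (auto simp: D_def indicator_def intro!: ennreal_leI)
    also have "\<dots> < \<infinity>"
      using s u by (simp add: nn_integral_cmult_indicator ennreal_mult_less_top)
    finally show ?thesis .
  qed
  have fin: "finite_measure \<eta>"
    unfolding \<eta>_def using fin_N by (intro finite_measure.finite_measure_distr[OF _ F] finite_measureI) (simp add: N_def)
  \<comment> \<open>For \<open>u = 0\<close> the second law has weight zero, but its scale must be positive.\<close>
  define sc where "sc j = (if j = 0 \<or> u = 0 then s else u)" for j :: nat
  define w where "w j = (if j = 0 then (1 - \<rho>) * s\<^sup>2 / r\<^sup>2 else \<rho> * u\<^sup>2 / r\<^sup>2)" for j :: nat
  have cov: "1 \<le> coverage T r \<eta> x + (\<Sum>j<2. w j)" if x: "x \<in> X" for x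
  proof -
    define G1 where "G1 = {t \<in> {s<..r}. d x (c t) \<le> t}"
    define G2 where "G2 = {t \<in> {u<..s}. d x (c' t) \<le> t}"
    have fm: "G1 \<in> fmeasurable lborel" "G2 \<in> fmeasurable lborel"
      unfolding G1_def G2_def by (intro covering_radii_fmeasurable x c c')+
    then have [measurable]: "G1 \<in> sets borel" "G2 \<in> sets borel"
      by (auto simp: fmeasurable_def)
    define Z where "Z = {(v, s). (v, s) \<in> X \<times> {0..r} \<and> d x v \<le> s}"
    have Z: "Z \<in> sets ?B" unfolding Z_def by (rule coverage_set_measurable[OF tree x])
    have FZ: "F -` Z \<in> sets borel" using measurable_sets[OF F_borel Z] by simp
    have CX: "C v \<in> X" for v
      using c c' by (auto simp: C_def continuous_map_def)
    have "ennreal (K * (measure lborel G1 + \<rho> * measure lborel G2)) =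
        ennreal K * emeasure lborel G1 + ennreal (\<rho> * K) * emeasure lborel G2"
    proof -
      have "emeasure lborel G1 = measure lborel G1" "emeasure lborel G2 = measure lborel G2"
        using fm by (auto simp: fmeasurable_def intro!: emeasure_eq_ennreal_measure)
      then show ?thesis using K \<rho>
        by (simp add: ennreal_mult[symmetric] ennreal_plus[symmetric] algebra_simps del: ennreal_plus)
    qed
    also have "\<dots> = (\<integral>\<^sup>+v. ennreal K * indicator G1 v + ennreal (\<rho> * K) * indicator G2 v \<partial>lborel)"
      by (simp add: nn_integral_add nn_integral_cmult_indicator)
    also have "\<dots> \<le> (\<integral>\<^sup>+v. ennreal (D v) * indicator (F -` Z) v \<partial>lborel)"
      using s u CX by (intro nn_integral_mono)
        (auto simp: D_def G1_def G2_def Z_def F_def C_def cl_def indicator_def)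
    also have "\<dots> = emeasure \<eta> Z"
      unfolding \<eta>_def using F Z by (simp add: emeasure_distr N_em[OF FZ, symmetric]) (simp add: N_def)
    also have "\<dots> = ennreal (coverage T r \<eta> x)"
      unfolding coverage_def Z_def[symmetric]
      by (rule finite_measure.emeasure_eq_measure[OF fin])
    finally have "K * (measure lborel G1 + \<rho> * measure lborel G2) \<le> coverage T r \<eta> x"
      by (simp add: coverage_def)
    moreover have "K * (r - s) \<le> K * (measure lborel G1 + \<rho> * measure lborel G2)"
      using cover[OF x] K unfolding G1_def G2_def by (intro mult_left_mono)
    ultimately show ?thesis using total by (simp add: w_def K_def numeral_2_eq_2)
  qed
  have marg: "emeasure (distr \<eta> borel snd) A + (\<Sum>j<2. ennreal (w j) * emeasure (scale_law T (sc j)) A)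
      \<le> emeasure (scale_law T r) A" if A: "A \<in> sets borel" for A
  proof -
    have "emeasure (distr \<eta> borel snd) A = emeasure N ((snd \<circ> F) -` A)"
      using A F snd_measurable_scale_space[of T r] measurable_comp[OF F snd_measurable_scale_space]
      by (simp add: \<eta>_def distr_distr emeasure_distr) (simp add: N_def)
    also have "snd \<circ> F = cl" by (auto simp: F_def)
    also have "emeasure N (cl -` A) = (\<integral>\<^sup>+v. ennreal (D v) * indicator (cl -` A) v \<partial>lborel)"
    proof (rule N_em)
      have "cl \<in> borel_measurable borel" unfolding cl_def by measurable
      then show "cl -` A \<in> sets borel" using A measurable_sets[of cl borel borel A] by simp
    qed
    also have "\<dots> = (\<integral>\<^sup>+v. ennreal (D v) * indicator A v \<partial>lborel)"
      using s u by (intro nn_integral_cong) (auto simp: D_def cl_def indicator_def)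
    finally have 1: "emeasure (distr \<eta> borel snd) A = (\<integral>\<^sup>+v. ennreal (D v) * indicator A v \<partial>lborel)" .
    define E where "E j v = w j * (total_length T / (sc j)\<^sup>2 * indicator {0..sc j} v)" for j v
    have sc: "0 < sc j" for j using s u by (auto simp: sc_def)
    have w: "0 \<le> w j" for j using \<rho> by (simp add: w_def)
    have E0: "0 \<le> E j v" for j v using w[of j] total_length_nonneg by (simp add: E_def)
    have E_meas: "E j \<in> borel_measurable borel" for j unfolding E_def by measurable
    have 2: "ennreal (w j) * emeasure (scale_law T (sc j)) A =
        (\<integral>\<^sup>+v. ennreal (E j v) * indicator A v \<partial>lborel)" for j
      unfolding emeasure_scale_law[OF sc total_length_nonneg A]
      using A w[of j] total_length_nonneg
      by (subst nn_integral_cmult[symmetric]) (auto simp: E_def ennreal_mult[symmetric] mult.assoc[symmetric])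
    have pw: "D v + (E 0 v + E 1 v) \<le> total_length T / r\<^sup>2 * indicator {0..r} v" for v
    proof -
      have e0: "E 0 v = (1 - \<rho>) * K * indicator {0..s} v"
        using s by (simp add: E_def w_def sc_def K_def)
      have e1: "E 1 v \<le> \<rho> * K * indicator {0..u} v"
      proof (cases "u = 0")
        case True
        then have "E 1 v = 0" by (simp add: E_def w_def)
        then show ?thesis using K \<rho> by simp
      qed (simp add: E_def w_def sc_def K_def)
      have "D v + (E 0 v + E 1 v) \<le> K * indicator {s<..r} v + \<rho> * K * indicator {u<..s} v +
          ((1 - \<rho>) * K * indicator {0..s} v + \<rho> * K * indicator {0..u} v)"
        using e0 e1 unfolding D_def by linarith
      also have "\<dots> \<le> K * indicator {0..r} v"
        using s u K by (auto simp: indicator_def algebra_simps)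
      finally show ?thesis by (simp add: K_def)
    qed
    have "emeasure (distr \<eta> borel snd) A + (\<Sum>j<2. ennreal (w j) * emeasure (scale_law T (sc j)) A) =
        (\<integral>\<^sup>+v. ennreal (D v) * indicator A v \<partial>lborel) +
        ((\<integral>\<^sup>+v. ennreal (E 0 v) * indicator A v \<partial>lborel) + (\<integral>\<^sup>+v. ennreal (E 1 v) * indicator A v \<partial>lborel))"
      unfolding 1 2 by (simp add: numeral_2_eq_2)
    also have "\<dots> = (\<integral>\<^sup>+v. ennreal (D v) * indicator A v + (ennreal (E 0 v) * indicator A v
        + ennreal (E 1 v) * indicator A v) \<partial>lborel)"
      using A D_meas E_meas by (simp add: nn_integral_add)
    also have "\<dots> \<le> (\<integral>\<^sup>+v. ennreal (total_length T / r\<^sup>2 * indicator {0..r} v) * indicator A v \<partial>lborel)"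
      using ennreal_leI[OF pw] D0 E0
      by (intro nn_integral_mono) (simp add: indicator_def)
    also have "\<dots> = emeasure (scale_law T r) A"
      using s by (intro emeasure_scale_law[symmetric] total_length_nonneg A) simp
    finally show ?thesis .
  qed
  have "space \<eta> = X \<times> {0..r}" "sets \<eta> = sets ?B"
    by (simp_all add: \<eta>_def space_borel_of topspace_scale_space[OF tree])
  moreover have "\<forall>j<2. 0 < sc j \<and> sc j < r \<and> 0 \<le> w j"
    using s u \<rho> by (simp add: sc_def w_def)
  ultimately have "replacement_certificate T r \<eta> 2 sc w"
    using fin cov marg by (simp add: replacement_certificate_def)
  moreover have "\<forall>j<2. sc j \<le> s" using u by (simp add: sc_def)
  ultimately show ?thesis by blast
qed

end

theorem proposition3p7:
  fixes T :: "'v length_graph" and r L :: real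
  assumes "0 < r"
    and "finite_metric_tree T"
    and "total_length T = L"
    and "2 * r \<le> L"
    and "tree_lambda T < 2 * r"
  shows "\<exists>\<eta> q s w. replacement_certificate T r \<eta> q s w \<and> (\<forall>j<q. s j \<le> tree_lambda T / 2)"
proof -
  interpret metric_tree T by unfold_locales (rule assms)
  define s where "s = tree_lambda T / 2"
  define b where "b = L - 2 * s"
  \<comment> \<open>Radii in \<open>(s, m]\<close> need a partner, and the radii up to \<open>u\<close> are too small to be partners.\<close>
  define m where "m = max s (min b r)"
  define u where "u = max 0 (b - r)"
  define \<rho> where "\<rho> = (m - s) / (s - u)"
  obtain c c' where c: "continuous_map euclideanreal mtopology c"
    and c': "continuous_map euclideanreal mtopology c'"
    and one: "\<And>t x. s \<le> t \<Longrightarrow> b \<le> t \<Longrightarrow> x \<in> X \<Longrightarrow> d x (c t) \<le> t"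
    and two: "\<And>t v x. s \<le> t \<Longrightarrow> 0 \<le> v \<Longrightarrow> b \<le> t + v \<Longrightarrow> x \<in> X \<Longrightarrow>
      d x (c t) \<le> t \<or> d x (c' v) \<le> v"
    using two_balls_cover assms(3) by (auto simp: s_def b_def)
  obtain p S where "branch_union p S" "total_length T \<le> 2 * tree_lambda T"
    using optimal_split_exists by blast
  then have "L \<le> 4 * s" using assms(3) by (simp add: s_def)
  then have s: "r / 2 \<le> s" "s < r" "0 < s" "b \<le> 2 * s"
    using assms by (auto simp: s_def b_def)
  have u: "0 \<le> u" "u < s" using s by (auto simp: u_def)
  have m: "s \<le> m" "m \<le> r" "m - s \<le> s - u" using s by (auto simp: m_def u_def)
  have \<rho>: "0 \<le> \<rho>" "\<rho> \<le> 1" "\<rho> * (s - u) = m - s" using m u by (auto simp: \<rho>_def)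
  have m_beyond: "b \<le> t" if "m < t" "t \<le> r" for t using that by (auto simp: m_def)
  have "1 \<le> L / r\<^sup>2 * (r - s) + (1 - \<rho>) * s\<^sup>2 / r\<^sup>2 + \<rho> * u\<^sup>2 / r\<^sup>2"
  proof -
    have "\<rho> * (s\<^sup>2 - u\<^sup>2) = (m - s) * (s + u)"
      unfolding \<rho>(3)[symmetric] by (simp add: power2_eq_square algebra_simps)
    moreover have "r\<^sup>2 \<le> L * (r - s) + s\<^sup>2 - (m - s) * (s + u)"
    proof -
      consider "r \<le> b" | "s \<le> b" "b < r" | "b < s" by linarith
      then show ?thesis
      proof cases
        case 1
        then have mu: "m = r" "L = r + u + 2 * s" using s by (auto simp: m_def u_def b_def)
        show ?thesis unfolding mu by (simp add: power2_eq_square algebra_simps)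
      next
        case 2
        then have mu: "m = b" "u = 0" using s by (auto simp: m_def u_def)
        have "0 \<le> (r - b) * (2 * s - r)" using 2 s by simp
        then show ?thesis unfolding mu by (simp add: b_def power2_eq_square algebra_simps)
      next
        case 3
        then have mu: "m = s" "u = 0" using s by (auto simp: m_def u_def)
        have "2 * r * (r - s) \<le> L * (r - s)" using assms s by (intro mult_right_mono) auto
        moreover have "0 \<le> (r - s)\<^sup>2" by simp
        ultimately show ?thesis unfolding mu by (simp add: power2_eq_square algebra_simps)
      qed
    qed
    ultimately have "r\<^sup>2 \<le> L * (r - s) + (1 - \<rho>) * s\<^sup>2 + \<rho> * u\<^sup>2"
      by (simp add: algebra_simps)
    then have "r\<^sup>2 / r\<^sup>2 \<le> (L * (r - s) + (1 - \<rho>) * s\<^sup>2 + \<rho> * u\<^sup>2) / r\<^sup>2"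
      by (rule divide_right_mono) simp
    then show ?thesis using assms(1) by (simp add: add_divide_distrib)
  qed
  moreover have "r - s \<le> measure lborel {t \<in> {s<..r}. d x (c t) \<le> t}
      + \<rho> * measure lborel {t \<in> {u<..s}. d x (c' t) \<le> t}" if x: "x \<in> X" for x
  proof -
    define G1 where "G1 = {t \<in> {s<..r}. d x (c t) \<le> t}"
    define G2 where "G2 = {t \<in> {u<..s}. d x (c' t) \<le> t}"
    have fm: "G1 \<in> fmeasurable lborel" "G2 \<in> fmeasurable lborel"
      unfolding G1_def G2_def by (intro covering_radii_fmeasurable x c c')+
    then have G: "G1 \<in> sets borel" "G2 \<in> sets borel"
      by (auto simp: fmeasurable_def)
    show ?thesis
    proof (cases "\<rho> = 0")
      case True
      then have "m = s" using \<rho>(3) by simp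
      then have "G1 = {s<..r}" using one[OF _ m_beyond x] by (auto simp: G1_def)
      then show ?thesis unfolding G1_def[symmetric] using True s by simp
    next
      case False
      then have pos: "0 < \<rho>" using \<rho> by simp
      \<comment> \<open>The partner of the radius \<open>t\<close>: the decreasing affine map from \<open>[s, m]\<close> onto \<open>[u, s]\<close>.\<close>
      define \<phi> where "\<phi> t = s - (t - s) / \<rho>" for t
      define H where "H = \<phi> -` G2"
      have [measurable]: "\<phi> \<in> borel_measurable borel" unfolding \<phi>_def by measurable
      have H: "H \<in> sets borel" using measurable_sets[of \<phi> borel borel G2] G by (simp add: H_def)
      have "emeasure lborel H = (\<integral>\<^sup>+t. indicator H t \<partial>lborel)" using H by simp
      \<comment> \<open>The substitution \<open>t = s + \<rho> s - \<rho> v\<close> inverts \<open>\<phi>\<close>.\<close>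
      also have "\<dots> = ennreal \<bar>- \<rho>\<bar> * (\<integral>\<^sup>+v. indicator H ((s + \<rho> * s) + - \<rho> * v) \<partial>lborel)"
        using H pos by (intro nn_integral_real_affine) auto
      also have "(\<lambda>v. indicator H ((s + \<rho> * s) + - \<rho> * v) :: ennreal) = indicator G2"
        using pos by (auto simp: fun_eq_iff H_def \<phi>_def indicator_def field_simps)
      finally have eH: "emeasure lborel H = ennreal \<rho> * emeasure lborel G2" using pos G by simp
      then have mH: "measure lborel H = \<rho> * measure lborel G2"
        using pos by (simp add: measure_def enn2real_mult)
      have "emeasure lborel H < \<infinity>"
        unfolding eH using fm by (simp add: fmeasurable_def ennreal_mult_less_top)
      then have fH: "H \<in> fmeasurable lborel" using H by (simp add: fmeasurable_def)
      \<comment> \<open>The partner of \<open>m\<close> is \<open>u\<close>, which the interval \<open>{u<..s}\<close> leaves out.\<close>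
      have "{s<..r} \<subseteq> (G1 \<union> H) \<union> {m}"
      proof
        fix t assume t: "t \<in> {s<..r}"
        consider "t = m" | "m < t" | "t < m" by linarith
        then show "t \<in> (G1 \<union> H) \<union> {m}"
        proof cases
          case 2
          then show ?thesis using one[of t x] m_beyond[of t] t x by (auto simp: G1_def)
        next
          case 3
          have "t - s < \<rho> * (s - u)" using 3 \<rho>(3) by simp
          then have lt: "(t - s) / \<rho> < s - u" using pos by (simp add: field_simps)
          have "0 < (t - s) / \<rho>" using t pos by simp
          then have \<phi>: "u < \<phi> t" "\<phi> t \<le> s" using lt by (auto simp: \<phi>_def)
          have "b \<le> t + \<phi> t"
          proof -
            have "(1 - \<rho>) * ((t - s) / \<rho>) \<le> (1 - \<rho>) * (s - u)"
              using lt \<rho>(2) by (intro mult_left_mono) auto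
            moreover have "(1 - \<rho>) * ((t - s) / \<rho>) = (t - s) / \<rho> - (t - s)"
              using pos by (simp add: field_simps)
            moreover have "(1 - \<rho>) * (s - u) = s - u - (m - s)"
              unfolding \<rho>(3)[symmetric] by (simp add: algebra_simps)
            moreover have "b \<le> m + u" by (auto simp: m_def u_def)
            ultimately show ?thesis unfolding \<phi>_def by linarith
          qed
          then have "d x (c t) \<le> t \<or> d x (c' (\<phi> t)) \<le> \<phi> t"
            using two[of t "\<phi> t" x] t \<phi> u x by simp
          then show ?thesis using t \<phi> by (auto simp: G1_def G2_def H_def)
        qed simp
      qed
      then have "measure lborel {s<..r} \<le> measure lborel ((G1 \<union> H) \<union> {m})"
      proof (rule measure_mono_fmeasurable)
        have "{m} \<in> fmeasurable lborel" by (simp add: fmeasurable_def)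
        then show "(G1 \<union> H) \<union> {m} \<in> fmeasurable lborel"
          using fm fH by (intro fmeasurable.Un)
      qed simp
      also have "\<dots> \<le> measure lborel (G1 \<union> H) + measure lborel {m}"
        using G H by (intro measure_Un_le) auto
      also have "measure lborel (G1 \<union> H) \<le> measure lborel G1 + measure lborel H"
        using G H by (intro measure_Un_le) auto
      finally show ?thesis using s mH by (simp add: G1_def G2_def)
    qed
  qed
  ultimately have "\<exists>\<eta> q sc w. replacement_certificate T r \<eta> q sc w \<and> (\<forall>j<q. sc j \<le> s)"
    using assms(3) by (intro two_curve_certificate[OF s(3,2) u \<rho>(1,2) c c']) auto
  then show ?thesis by (simp add: s_def)
qed

end
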